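(* For any canonical connection of a non-symmetric homogeneous description $\mathbb{C}\mathrm{H}(n)=G/H$, there exist two non-vanishing and non-collinear vector fields on $\mathbb{C}\mathrm{H}(n)$ that are parallel with respect to the canonical connection.
   Context: $\mathbb{C}\mathrm{H}(n)=\mathrm{SU}(n,1)/\mathrm{S}(\mathrm{U}(n)\mathrm{U}(1))$ is complex hyperbolic space with its Kähler metric of constant negative holomorphic sectional curvature. A non-symmetric homogeneous description is $\mathbb{C}\mathrm{H}(n)=G/H$ with $G=F_rN$, where $N$ is the nilpotent factor of the Iwasawa decomposition $KAN$ of $\mathrm{SU}(n,1)$, $F_r$ is a connected closed subgroup of $\mathrm{S}(\mathrm{U}(n-1)\mathrm{U}(1))A$ with non-trivial projection to $A\cong\mathbb{R}$ (here $\mathrm{S}(\mathrm{U}(n-1)\mathrm{U}(1))\subset K$ is the centralizer of $A$ in $K=\mathrm{S}(\mathrm{U}(n)\mathrm{U}(1))$), and $H=F_r\cap\mathrm{S}(\mathrm{U}(n-1)\mathrm{U}(1))$. (Together with $G=\mathrm{SU}(n,1)$ these are all the connected groups of isometries acting transitively.) A canonical connection is the one associated with a reductive decomposition $\mathfrak{g}=\mathfrak{h}+\mathfrak{m}$, with $\mathfrak{m}$ an $\mathrm{Ad}(H)$-invariant complement of $\mathfrak{h}$ (Kobayashi–Nomizu, Vol. II, Chapter X.2). *)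

theory Defs
  imports "HOL-Analysis.Analysis" "HOL-Algebra.Group"
begin

section \<open>Matrices\<close>

text \<open>
  Matrices of size \<open>n + 1\<close> are indexed by \<open>'n option\<close> with \<open>n = CARD('n)\<close>; the index \<open>None\<close> is the
  negative direction of the Hermitian form of signature \<open>(n, 1)\<close>. All spaces of matrices and
  vectors are regarded as real vector spaces (\<open>span\<close>, \<open>subspace\<close>, derivatives, \<open>collinear\<close>).
\<close>

type_synonym 'n cmat = "complex ^ 'n option ^ 'n option"

definition conj_transpose :: "complex ^ 'i ^ 'j \<Rightarrow> complex ^ 'j ^ 'i" where
  "conj_transpose A = (\<chi> i j. cnj (A $ j $ i))"

text \<open>The type \<open>complex ^ 'i ^ 'i\<close> carries the componentwise product, so powers and \<open>exp\<close> for
  matrices are not those of a library type class.\<close>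

definition mat_pow :: "complex ^ 'i ^ 'i \<Rightarrow> nat \<Rightarrow> complex ^ 'i ^ 'i" where
  "mat_pow A k = (((**) A) ^^ k) (mat 1)"

definition mat_exp :: "complex ^ 'i ^ 'i \<Rightarrow> complex ^ 'i ^ 'i" where
  "mat_exp A = (\<Sum>k. (1 / fact k) *\<^sub>R mat_pow A k)"

definition GL :: "(complex ^ 'i ^ 'i) monoid" where
  "GL = \<lparr>carrier = {A. invertible A}, mult = (**), one = mat 1\<rparr>"

definition mat_set_mult ::
    "(complex ^ 'i ^ 'i) set \<Rightarrow> (complex ^ 'i ^ 'i) set \<Rightarrow> (complex ^ 'i ^ 'i) set" where
  "mat_set_mult A B = {a ** b | a b. a \<in> A \<and> b \<in> B}"

text \<open>Intended for closed \<open>G\<close>.\<close>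

definition lie_algebra :: "(complex ^ 'i ^ 'i) set \<Rightarrow> (complex ^ 'i ^ 'i) set" where
  "lie_algebra G = {X. \<forall>t::real. mat_exp (t *\<^sub>R X) \<in> G}"


section \<open>The group \<open>SU(n,1)\<close> and its Iwasawa decompositions\<close>

definition form_matrix :: "'n::finite cmat" where
  "form_matrix = (\<chi> i j. if i = j then (if i = None then -1 else 1) else 0)"

definition SUn1 :: "'n::finite cmat set" where
  "SUn1 = {g. conj_transpose g ** form_matrix ** g = form_matrix \<and> det g = 1}"

definition su_n1 :: "'n::finite cmat set" where
  "su_n1 = {X. conj_transpose X ** form_matrix + form_matrix ** X = 0 \<and> trace X = 0}"

text \<open>\<open>K = S(U(n)U(1))\<close>: the block diagonal elements of \<open>SU(n,1)\<close>.\<close>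

definition maxK :: "'n::finite cmat set" where
  "maxK = {g \<in> SUn1. \<forall>i. g $ Some i $ None = 0 \<and> g $ None $ Some i = 0}"

text \<open>The complement of the Lie algebra of \<open>K\<close> in the Cartan decomposition. As \<open>SU(n,1)\<close> has real
  rank one, its maximal abelian subspaces are the lines spanned by its nonzero elements \<open>T\<close>, and the
  sign of \<open>T\<close> singles out the positive roots. Thus nonzero \<open>T\<close> account, up to positive scaling, for
  all the Iwasawa decompositions \<open>KAN\<close> with this \<open>K\<close>.\<close>

definition cartan_p :: "'n::finite cmat set" where
  "cartan_p = {X \<in> su_n1. conj_transpose X = X}"

definition iwasawa_A :: "'n::finite cmat \<Rightarrow> 'n cmat set" where
  "iwasawa_A T = range (\<lambda>t::real. mat_exp (t *\<^sub>R T))"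

definition root_space :: "'n::finite cmat \<Rightarrow> real \<Rightarrow> 'n cmat set" where
  "root_space T c = {X \<in> su_n1. T ** X - X ** T = c *\<^sub>R X}"

definition iwasawa_N :: "'n::finite cmat \<Rightarrow> 'n cmat set" where
  "iwasawa_N T = mat_exp ` span (\<Union>c\<in>{0<..}. root_space T c)"

text \<open>The centralizer of \<open>A\<close> in \<open>K\<close>, i.e. \<open>S(U(n-1)U(1))\<close>.\<close>

definition centralizer_M :: "'n::finite cmat \<Rightarrow> 'n cmat set" where
  "centralizer_M T = {k \<in> maxK. \<forall>a\<in>iwasawa_A T. k ** a = a ** k}"


section \<open>Complex hyperbolic space\<close>

text \<open>
  The unit ball model: \<open>z\<close> represents the negative line spanned by \<open>(z, 1)\<close>, and \<open>SU(n,1)\<close>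
  acts by fractional linear transformations, the stabilizer of \<open>0\<close> being \<open>S(U(n)U(1))\<close>.
  The tangent space at each point is \<open>complex ^ 'n\<close>.
\<close>

definition CH :: "(complex ^ 'n::finite) set" where
  "CH = ball 0 1"

definition lift :: "complex ^ 'n::finite \<Rightarrow> complex ^ 'n option" where
  "lift z = (\<chi> i. case i of None \<Rightarrow> 1 | Some j \<Rightarrow> z $ j)"

definition act :: "'n::finite cmat \<Rightarrow> complex ^ 'n \<Rightarrow> complex ^ 'n" where
  "act g z = (\<chi> i. (g *v lift z) $ Some i / (g *v lift z) $ None)"

definition dact :: "'n::finite cmat \<Rightarrow> complex ^ 'n \<Rightarrow> complex ^ 'n \<Rightarrow> complex ^ 'n" where
  "dact g p = frechet_derivative (act g) (at p)"

definition push_forward ::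
    "'n::finite cmat \<Rightarrow> (complex ^ 'n \<Rightarrow> complex ^ 'n) \<Rightarrow> complex ^ 'n \<Rightarrow> complex ^ 'n" where
  "push_forward g Y p = dact g (act (matrix_inv g) p) (Y (act (matrix_inv g) p))"


section \<open>Smooth vector fields and affine connections\<close>

text \<open>For open \<open>S\<close> in a finite-dimensional space this is the class \<open>C\<^sup>k\<close>.\<close>

primrec Ck_on :: "nat \<Rightarrow> 'a::real_normed_vector set \<Rightarrow> ('a \<Rightarrow> 'b::real_normed_vector) \<Rightarrow> bool" where
  "Ck_on 0 S f \<longleftrightarrow> continuous_on S f"
| "Ck_on (Suc k) S f \<longleftrightarrow>
     f differentiable_on S \<and> (\<forall>v. Ck_on k S (\<lambda>x. frechet_derivative f (at x) v))"

definition smooth_on :: "'a::real_normed_vector set \<Rightarrow> ('a \<Rightarrow> 'b::real_normed_vector) \<Rightarrow> bool" where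
  "smooth_on S f \<longleftrightarrow> (\<forall>k. Ck_on k S f)"

text \<open>
  On the open set \<open>CH\<close> the affine connections are exactly the sums of the standard flat connection
  and a smooth field \<open>\<Gamma>\<close> of real bilinear maps (the Christoffel symbols in the global chart).
\<close>

definition affine_connection :: "(complex ^ 'n::finite \<Rightarrow> complex ^ 'n \<Rightarrow> complex ^ 'n \<Rightarrow> complex ^ 'n) \<Rightarrow> bool"
  where
  "affine_connection \<Gamma> \<longleftrightarrow>
     (\<forall>p\<in>CH. bilinear (\<Gamma> p)) \<and> (\<forall>v w. smooth_on CH (\<lambda>p. \<Gamma> p v w))"

definition cov_deriv ::
    "(complex ^ 'n::finite \<Rightarrow> complex ^ 'n \<Rightarrow> complex ^ 'n \<Rightarrow> complex ^ 'n) \<Rightarrow>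
     (complex ^ 'n \<Rightarrow> complex ^ 'n) \<Rightarrow> complex ^ 'n \<Rightarrow> complex ^ 'n \<Rightarrow> complex ^ 'n" where
  "cov_deriv \<Gamma> Y p v = frechet_derivative Y (at p) v + \<Gamma> p v (Y p)"

definition parallel_field ::
    "(complex ^ 'n::finite \<Rightarrow> complex ^ 'n \<Rightarrow> complex ^ 'n \<Rightarrow> complex ^ 'n) \<Rightarrow>
     (complex ^ 'n \<Rightarrow> complex ^ 'n) \<Rightarrow> bool" where
  "parallel_field \<Gamma> Y \<longleftrightarrow> (\<forall>p\<in>CH. \<forall>v. cov_deriv \<Gamma> Y p v = 0)"

definition cov_deriv_along ::
    "(complex ^ 'n::finite \<Rightarrow> complex ^ 'n \<Rightarrow> complex ^ 'n \<Rightarrow> complex ^ 'n) \<Rightarrow>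
     (real \<Rightarrow> complex ^ 'n) \<Rightarrow> (real \<Rightarrow> complex ^ 'n) \<Rightarrow> real \<Rightarrow> complex ^ 'n" where
  "cov_deriv_along \<Gamma> c V t =
     vector_derivative V (at t) + \<Gamma> (c t) (vector_derivative c (at t)) (V t)"


section \<open>Canonical connections\<close>

definition reductive_decomposition ::
    "(complex ^ 'i ^ 'i) set \<Rightarrow> (complex ^ 'i ^ 'i) set \<Rightarrow> (complex ^ 'i ^ 'i) set \<Rightarrow> bool" where
  "reductive_decomposition G H \<mm> \<longleftrightarrow>
     subspace \<mm> \<and> \<mm> \<subseteq> lie_algebra G \<and>
     lie_algebra G = {X + Y | X Y. X \<in> lie_algebra H \<and> Y \<in> \<mm>} \<and>
     lie_algebra H \<inter> \<mm> = {0} \<and>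
     (\<forall>h\<in>H. \<forall>X\<in>\<mm>. h ** X ** matrix_inv h \<in> \<mm>)"

definition invariant_connection ::
    "'n::finite cmat set \<Rightarrow>
     (complex ^ 'n \<Rightarrow> complex ^ 'n \<Rightarrow> complex ^ 'n \<Rightarrow> complex ^ 'n) \<Rightarrow> bool" where
  "invariant_connection G \<Gamma> \<longleftrightarrow>
     (\<forall>g\<in>G. \<forall>Y. smooth_on CH Y \<longrightarrow> (\<forall>p\<in>CH. \<forall>v.
        dact g p (cov_deriv \<Gamma> Y p v) = cov_deriv \<Gamma> (push_forward g Y) (act g p) (dact g p v)))"

text \<open>
  Wang's map \<open>\<Lambda>\<close> of an invariant connection. For a frame \<open>u\<close> at the base point \<open>0\<close> and
  \<open>u t = d(exp (t X)) u\<close>, Kobayashi and Nomizu define \<open>\<Lambda>(X)\<close> as the value of the connection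
  form on the initial velocity of \<open>u\<close>; viewed as an endomorphism of the tangent space at \<open>0\<close>, it
  sends \<open>v\<close> to the covariant derivative at \<open>t = 0\<close> of \<open>t \<mapsto> d(exp (t X)) v\<close> along \<open>t \<mapsto> exp (t X) 0\<close>.
\<close>

definition wang_map ::
    "(complex ^ 'n::finite \<Rightarrow> complex ^ 'n \<Rightarrow> complex ^ 'n \<Rightarrow> complex ^ 'n) \<Rightarrow>
     'n cmat \<Rightarrow> complex ^ 'n \<Rightarrow> complex ^ 'n" where
  "wang_map \<Gamma> X v =
     cov_deriv_along \<Gamma> (\<lambda>t. act (mat_exp (t *\<^sub>R X)) 0) (\<lambda>t. dact (mat_exp (t *\<^sub>R X)) 0 v) 0"

text \<open>The canonical connection (of the second kind) of a reductive decomposition with complement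
  \<open>\<mm>\<close> is the invariant connection whose map \<open>\<Lambda>\<close> vanishes on \<open>\<mm>\<close>.\<close>

definition canonical_connection ::
    "'n::finite cmat set \<Rightarrow> 'n cmat set \<Rightarrow>
     (complex ^ 'n \<Rightarrow> complex ^ 'n \<Rightarrow> complex ^ 'n \<Rightarrow> complex ^ 'n) \<Rightarrow> bool" where
  "canonical_connection G \<mm> \<Gamma> \<longleftrightarrow>
     affine_connection \<Gamma> \<and> invariant_connection G \<Gamma> \<and> (\<forall>X\<in>\<mm>. \<forall>v. wang_map \<Gamma> X v = 0)"

end

(*
  Let u be the ideal point towards which T points; the null vector xi = (u, 1) is an eigenvector of
  the centralizer M of A in K, of A and of N, hence of every element of G. Moving the negative line
  spanned by y in the direction (<y,y> / <xi,y>) xi defines a vector field W on the ball that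
  depends on the line spanned by xi only, so W and iW are G-invariant; they are nowhere zero and
  linearly independent over the reals. For an invariant field Y and X in the reductive complement, the curve
  d(exp tX) Y(0) is Y along exp(tX) 0, so that the Wang map turns the definition of the canonical
  connection into the vanishing of the covariant derivative of Y at 0 in the direction X 0. Since
  the complement maps onto the tangent space at 0 and G is transitive, Y is parallel.

  Surjectivity and transitivity need a one-parameter subgroup of F moving the horospheres at u. It
  comes from the closed subgroup argument: F has elements g_k -> 1 outside M because it is
  connected, and the limit direction of g_k - 1 is not tangent to M if every g_k is nearly closest
  to 1 in its coset modulo M.
*)
theory Submission
  imports Defs
begin

section \<open>The matrix exponential\<close>

text \<open>Invariant fields on G/H correspond to the tangent vectors at 0 fixed by H. An element of
  M multiplies xi and \<open>lift 0\<close> by the same scalar, so its differential at 0 fixes u,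
  and also iu since the action is holomorphic: this is the direction of A and its image under the
  complex structure. A closed formula for the field, in place of transport of u along G/H, reduces
  smoothness to rational expressions in z and its conjugate, and invariance to homogeneity. That xi
  is a common eigenvector comes from the spectrum of T: the top eigenvalue is simple, so the
  centralizer keeps the eigenline, and a positive root vector would raise the eigenvalue above the
  spectrum, so it kills xi. The obstacle is that F is given as a group of matrices, while
  transitivity and the reductive complement need a velocity. The modulus of the eigenvalue on xi is
  a continuous character of F that sees exactly the A-part, so the closed subgroup argument is run
  for an abstract character.\<close>

lemma bounded_bilinear_matrix_matrix_mult:
  "bounded_bilinear ((**) :: complex ^ 'k::finite ^ 'i::finite \<Rightarrow> complex ^ 'j::finite ^ 'k \<Rightarrow> complex ^ 'j ^ 'i)"
  unfolding bilinear_conv_bounded_bilinear[symmetric] bilinear_def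
  by (auto intro!: linearI simp: vec_eq_iff matrix_matrix_mult_def sum.distrib distrib_left
      distrib_right scaleR_sum_right)

lemma bounded_bilinear_matrix_vector_mult:
  "bounded_bilinear ((*v) :: complex ^ 'k::finite ^ 'i::finite \<Rightarrow> complex ^ 'k \<Rightarrow> complex ^ 'i)"
  unfolding bilinear_conv_bounded_bilinear[symmetric] bilinear_def
  by (auto intro!: linearI simp: vec_eq_iff matrix_vector_mult_def sum.distrib distrib_left
      distrib_right scaleR_sum_right)

interpretation mm: bounded_bilinear
  "(**) :: complex ^ 'k::finite ^ 'i::finite \<Rightarrow> complex ^ 'j::finite ^ 'k \<Rightarrow> complex ^ 'j ^ 'i"
  by (rule bounded_bilinear_matrix_matrix_mult)

interpretation mv: bounded_bilinear
  "(*v) :: complex ^ 'k::finite ^ 'i::finite \<Rightarrow> complex ^ 'k \<Rightarrow> complex ^ 'i"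
  by (rule bounded_bilinear_matrix_vector_mult)

lemma mat_pow_0 [simp]: "mat_pow A 0 = mat 1"
  and mat_pow_Suc: "mat_pow A (Suc k) = A ** mat_pow A k"
  by (simp_all add: mat_pow_def)

lemma mat_pow_commute: "mat_pow A k ** A = A ** mat_pow A k"
  by (induction k) (simp_all add: mat_pow_Suc matrix_mul_assoc[symmetric])

lemma mat_pow_scaleR: "mat_pow (t *\<^sub>R A) k = t ^ k *\<^sub>R mat_pow A k"
  by (induction k) (simp_all add: mat_pow_Suc mm.scaleR_left mm.scaleR_right)

text \<open>Geometric growth is what \<open>mat_exp_sums\<close> compares with the scalar
  exponential series. The constant of bilinearity goes into \<open>C\<close>; the factor
  \<open>norm (mat 1)\<close> is the power 0.\<close>

lemma mat_pow_bound: "\<exists>C. \<forall>k. norm (mat_pow (A :: complex ^ 'i::finite ^ 'i) k) \<le> norm (mat 1 :: complex ^ 'i ^ 'i) * C ^ k"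
proof -
  obtain K where K: "K > 0" "\<And>(B :: complex ^ 'i ^ 'i) (C :: complex ^ 'i ^ 'i). norm (B ** C) \<le> norm B * norm C * K"
    using mm.pos_bounded by blast
  have "norm (mat_pow A k) \<le> norm (mat 1 :: complex ^ 'i ^ 'i) * (norm A * K) ^ k" for k
  proof (induction k)
    case (Suc k)
    have "norm (mat_pow A (Suc k)) \<le> norm A * norm (mat_pow A k) * K"
      unfolding mat_pow_Suc by (rule K(2))
    also have "\<dots> \<le> norm A * (norm (mat 1 :: complex ^ 'i ^ 'i) * (norm A * K) ^ k) * K"
      using Suc K(1) by (intro mult_right_mono mult_left_mono) auto
    finally show ?case by (simp add: mult_ac)
  qed simp
  then show ?thesis by blast
qed

lemma mat_exp_sums: "(\<lambda>k. (1 / fact k) *\<^sub>R mat_pow (A :: complex ^ 'i::finite ^ 'i) k) sums mat_exp A"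
proof -
  obtain C where C: "\<And>k. norm (mat_pow A k) \<le> norm (mat 1 :: complex ^ 'i ^ 'i) * C ^ k"
    using mat_pow_bound by blast
  have "summable (\<lambda>k. norm (mat 1 :: complex ^ 'i ^ 'i) * (inverse (fact k) * C ^ k))"
    by (intro summable_mult summable_exp)
  then have "summable (\<lambda>k. (1 / fact k) *\<^sub>R mat_pow A k)"
  proof (rule summable_comparison_test')
    fix k :: nat
    show "norm ((1 / fact k) *\<^sub>R mat_pow A k)
        \<le> norm (mat 1 :: complex ^ 'i ^ 'i) * (inverse (fact k) * C ^ k)"
      using mult_left_mono[OF C[of k], of "inverse (fact k)"] by (simp add: field_simps)
  qed
  then show ?thesis
    by (simp add: mat_exp_def summable_sums)
qed

lemma mat_exp_0 [simp]: "mat_exp (0 :: complex ^ 'i::finite ^ 'i) = mat 1"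
proof -
  have "mat_pow (0 :: complex ^ 'i ^ 'i) k = (if k = 0 then mat 1 else 0)" for k
    by (cases k) (simp_all add: mat_pow_Suc mm.zero_left)
  then have "(1 / fact k) *\<^sub>R mat_pow (0 :: complex ^ 'i ^ 'i) k = (if k = 0 then mat 1 else 0)" for k
    by simp
  then have "(\<lambda>k. if k = 0 then mat 1 else 0) sums mat_exp (0 :: complex ^ 'i ^ 'i)"
    using mat_exp_sums[of "0 :: complex ^ 'i ^ 'i"] by simp
  moreover have "(\<lambda>k. if k = 0 then mat 1 else 0) sums (mat 1 :: complex ^ 'i ^ 'i)"
    using sums_single[of 0 "\<lambda>_. mat 1 :: complex ^ 'i ^ 'i"] by simp
  ultimately show ?thesis using sums_unique2 by blast
qed

lemma mat_exp_mult_commute: "mat_exp A ** A = A ** mat_exp (A :: complex ^ 'i::finite ^ 'i)"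
proof -
  have "(\<lambda>k. ((1 / fact k) *\<^sub>R mat_pow A k) ** A) sums (mat_exp A ** A)"
    by (rule mm.bounded_linear_left[THEN bounded_linear.sums, OF mat_exp_sums])
  moreover have "(\<lambda>k. A ** ((1 / fact k) *\<^sub>R mat_pow A k)) sums (A ** mat_exp A)"
    by (rule mm.bounded_linear_right[THEN bounded_linear.sums, OF mat_exp_sums])
  ultimately show ?thesis
    by (simp add: mm.scaleR_left mm.scaleR_right mat_pow_commute sums_unique2)
qed

text \<open>Turns the derivative of the matrix exponential into that of scalar power series, one for
  each entry.\<close>

lemma has_vector_derivative_vec:
  fixes f :: "real \<Rightarrow> 'a::euclidean_space ^ 'i::finite"
  assumes "\<And>i. ((\<lambda>t. f t $ i) has_vector_derivative f' $ i) (at t)"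
  shows "(f has_vector_derivative f') (at t)"
  unfolding has_vector_derivative_def
proof (subst has_derivative_componentwise_within, rule ballI)
  fix b :: "'a ^ 'i" assume "b \<in> Basis"
  then obtain i e where b: "b = axis i e" by (auto simp: Basis_vec_def)
  have "((\<lambda>t. f t $ i \<bullet> e) has_derivative (\<lambda>h. (h *\<^sub>R f' $ i) \<bullet> e)) (at t)"
    using assms[of i] unfolding has_vector_derivative_def by (rule has_derivative_inner_left)
  then show "((\<lambda>t. f t \<bullet> b) has_derivative (\<lambda>h. (h *\<^sub>R f') \<bullet> b)) (at t)"
    by (simp add: b inner_axis)
qed

lemma mat_exp_has_vector_derivative:
  fixes A :: "complex ^ 'i::finite ^ 'i"
  shows "((\<lambda>t. mat_exp (t *\<^sub>R A)) has_vector_derivative A ** mat_exp (t *\<^sub>R A)) (at t)"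
proof (intro has_vector_derivative_vec)
  fix i j
  define c where "c k = mat_pow A k $ i $ j / fact k" for k
  have lin: "bounded_linear (\<lambda>B :: complex ^ 'i ^ 'i. B $ i $ j)"
    by (intro bounded_linear_compose[OF bounded_linear_vec_nth bounded_linear_vec_nth])
  have eq: "((1 / fact k) *\<^sub>R mat_pow (s *\<^sub>R A) k) $ i $ j = c k * of_real s ^ k" for k s
    by (simp add: c_def mat_pow_scaleR scaleR_conv_of_real[where 'a=complex])
  have sums: "(\<lambda>k. c k * of_real s ^ k) sums mat_exp (s *\<^sub>R A) $ i $ j" for s :: real
    using bounded_linear.sums[OF lin mat_exp_sums[of "s *\<^sub>R A"]] unfolding eq .
  \<comment> \<open>Termwise differentiation needs convergence at every complex point, whereas
    \<open>sums\<close> covers the real ones; real points of larger modulus supply it.\<close>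
  have summ: "summable (\<lambda>k. c k * z ^ k)" for z :: complex
  proof -
    have "summable (\<lambda>k. norm ((c k * of_real (norm z + 1) ^ k)))"
    proof (rule powser_insidea[where x = "of_real (norm z + 2)"])
      show "summable (\<lambda>k. c k * complex_of_real (norm z + 2) ^ k)"
        using sums[of "norm z + 2"] sums_summable by blast
      show "norm (complex_of_real (norm z + 1)) < norm (complex_of_real (norm z + 2))"
        unfolding norm_of_real by simp
    qed
    moreover have "norm z < norm (complex_of_real (norm z + 1))"
      unfolding norm_of_real by simp
    ultimately show ?thesis
      by (rule powser_inside[OF summable_norm_cancel])
  qed
  have "((\<lambda>z. \<Sum>k. c k * z ^ k) has_field_derivative (\<Sum>k. diffs c k * of_real t ^ k)) (at (of_real t))"
    by (rule termdiffs_strong_converges_everywhere[OF summ])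
  then have "((\<lambda>s. \<Sum>k. c k * of_real s ^ k) has_vector_derivative (\<Sum>k. diffs c k * of_real t ^ k)) (at t)"
    by (rule has_vector_derivative_real_field)
  moreover have "(\<Sum>k. c k * of_real s ^ k) = mat_exp (s *\<^sub>R A) $ i $ j" for s :: real
    using sums[of s] by (simp add: sums_iff)
  moreover have "(\<lambda>k. diffs c k * of_real t ^ k) sums (A ** mat_exp (t *\<^sub>R A)) $ i $ j"
  proof -
    \<comment> \<open>The factor k + 1 in \<open>diffs\<close> cancels against the factorial and
      leaves one extra factor \<open>A\<close>.\<close>
    have "diffs c k * of_real t ^ k = (A ** ((1 / fact k) *\<^sub>R mat_pow (t *\<^sub>R A) k)) $ i $ j" for k
      by (simp add: diffs_def c_def mat_pow_scaleR mm.scaleR_right mat_pow_Suc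
          scaleR_conv_of_real[where 'a=complex] field_simps del: of_nat_Suc)
    then show ?thesis
      using bounded_linear.sums[OF lin mm.bounded_linear_right[THEN bounded_linear.sums, OF mat_exp_sums[of "t *\<^sub>R A"]], of A]
      by simp
  qed
  ultimately show "((\<lambda>s. mat_exp (s *\<^sub>R A) $ i $ j) has_vector_derivative (A ** mat_exp (t *\<^sub>R A)) $ i $ j) (at t)"
    by (simp add: sums_iff)
qed

lemma has_vector_derivative_zero_imp_const:
  fixes f :: "real \<Rightarrow> 'a::real_normed_vector"
  assumes "\<And>t. (f has_vector_derivative 0) (at t)"
  shows "f s = f t"
  using has_vector_derivative_zero_constant[of UNIV f] assms by (metis convex_UNIV UNIV_I)

lemma has_vector_derivative_reflect:
  assumes "\<And>t. (f has_vector_derivative f' t) (at t)"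
  shows "((\<lambda>t. f (- t)) has_vector_derivative - f' (- t)) (at t)"
  using vector_diff_chain_at[of uminus "-1" t f "f' (- t)"] assms[of "- t"]
    has_vector_derivative_minus[OF has_vector_derivative_id, of "at t"]
  by (auto simp: o_def)

lemma mat_exp_scaleR_commute: "mat_exp (t *\<^sub>R A) ** A = A ** mat_exp (t *\<^sub>R (A :: complex ^ 'i::finite ^ 'i))"
proof (cases "t = 0")
  case False
  then show ?thesis
    using mat_exp_mult_commute[of "t *\<^sub>R A"] by (simp add: mm.scaleR_left mm.scaleR_right)
qed simp

text \<open>The product is a curve with zero derivative, hence equal to its value at 0.
  \<open>mat_exp_add\<close> and \<open>isometric_mat_exp\<close> follow the same pattern.\<close>

lemma mat_exp_minus_mult: "mat_exp ((- t) *\<^sub>R A) ** mat_exp (t *\<^sub>R A) = mat 1"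
  for A :: "complex ^ 'i::finite ^ 'i"
proof -
  have "((\<lambda>t. mat_exp ((- t) *\<^sub>R A) ** mat_exp (t *\<^sub>R A)) has_vector_derivative 0) (at t)" for t
    using mm.has_vector_derivative[OF has_vector_derivative_reflect[OF mat_exp_has_vector_derivative[of A], of t]
        mat_exp_has_vector_derivative[of A t]]
    by (simp add: mm.minus_left matrix_mul_assoc mat_exp_scaleR_commute[of "- t", simplified])
  from has_vector_derivative_zero_imp_const[OF this, of t 0] show ?thesis by simp
qed


lemma mat_exp_mult_minus: "mat_exp (t *\<^sub>R A) ** mat_exp ((- t) *\<^sub>R A) = mat 1"
  for A :: "complex ^ 'i::finite ^ 'i"
  using mat_exp_minus_mult[of "- t" A] by simp

lemma mat_exp_add: "mat_exp ((s + t) *\<^sub>R A) = mat_exp (s *\<^sub>R A) ** mat_exp (t *\<^sub>R A)"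
  for A :: "complex ^ 'i::finite ^ 'i"
proof -
  have "((\<lambda>s. mat_exp ((- s) *\<^sub>R A) ** mat_exp ((s + t) *\<^sub>R A)) has_vector_derivative 0) (at s)" for s
  proof -
    have "((\<lambda>s. mat_exp ((s + t) *\<^sub>R A)) has_vector_derivative A ** mat_exp ((s + t) *\<^sub>R A)) (at s)"
      using vector_diff_chain_at[of "\<lambda>s. s + t" 1 s "\<lambda>t. mat_exp (t *\<^sub>R A)", OF _ mat_exp_has_vector_derivative,
          OF has_vector_derivative_add_const[THEN iffD2, OF has_vector_derivative_id]]
      by (simp add: o_def)
    from mm.has_vector_derivative[OF has_vector_derivative_reflect[OF mat_exp_has_vector_derivative[of A], of s] this]
    show ?thesis
      by (simp add: mm.minus_left matrix_mul_assoc mat_exp_scaleR_commute[of "- s", simplified])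
  qed
  from has_vector_derivative_zero_imp_const[OF this, of s 0]
  have "mat_exp ((- s) *\<^sub>R A) ** mat_exp ((s + t) *\<^sub>R A) = mat_exp (t *\<^sub>R A)"
    by simp
  then have "mat_exp (s *\<^sub>R A) ** (mat_exp ((- s) *\<^sub>R A) ** mat_exp ((s + t) *\<^sub>R A))
      = mat_exp (s *\<^sub>R A) ** mat_exp (t *\<^sub>R A)" by simp
  then show ?thesis by (simp only: matrix_mul_assoc mat_exp_mult_minus matrix_mul_lid)
qed

lemma mat_exp_of_nat: "mat_exp ((real m * t) *\<^sub>R A) = mat_pow (mat_exp (t *\<^sub>R A)) m"
  for A :: "complex ^ 'i::finite ^ 'i"
proof (induction m)
  case (Suc m)
  then show ?case
    using mat_exp_add[of t "real m * t" A] by (simp add: mat_pow_Suc algebra_simps)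
qed simp

lemma mat_exp_vec_has_vector_derivative:
  "((\<lambda>t. mat_exp (t *\<^sub>R A) *v y) has_vector_derivative A *v (mat_exp (t *\<^sub>R A) *v y)) (at t)"
  for A :: "complex ^ 'i::finite ^ 'i"
  using bounded_linear.has_vector_derivative[OF mv.bounded_linear_left mat_exp_has_vector_derivative]
  by (simp add: matrix_vector_mul_assoc)

lemma matrix_vector_mult_smult: "A *v (c *s y) = c *s (A *v y)"
  for A :: "complex ^ 'k::finite ^ 'i::finite"
  by (simp add: vec_eq_iff matrix_vector_mult_def sum_distrib_left mult_ac)

lemma bounded_bilinear_smult: "bounded_bilinear ((*s) :: complex \<Rightarrow> complex ^ 'i::finite \<Rightarrow> complex ^ 'i)"
  unfolding bilinear_conv_bounded_bilinear[symmetric] bilinear_def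
  by (auto intro!: linearI simp: vec_eq_iff algebra_simps)

interpretation sm: bounded_bilinear "(*s) :: complex \<Rightarrow> complex ^ 'i::finite \<Rightarrow> complex ^ 'i"
  by (rule bounded_bilinear_smult)

lemma mat_exp_vec_sums: "(\<lambda>k. (1 / fact k) *\<^sub>R (mat_pow A k *v y)) sums (mat_exp A *v y)"
  for A :: "complex ^ 'i::finite ^ 'i"
  using mv.bounded_linear_left[THEN bounded_linear.sums, OF mat_exp_sums, of A y]
  by (simp add: mv.scaleR_left)

lemma mat_exp_eigenvector:
  fixes A :: "complex ^ 'i::finite ^ 'i"
  assumes "A *v y = c *s y"
  shows "mat_exp A *v y = exp c *s y"
proof -
  have "mat_pow A k *v y = c ^ k *s y" for k
    by (induction k) (simp_all add: mat_pow_Suc matrix_vector_mul_assoc[symmetric] assms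
        matrix_vector_mult_smult vector_smult_assoc mult_ac)
  then have "(\<lambda>k. (c ^ k /\<^sub>R fact k) *s y) sums (mat_exp A *v y)"
    using mat_exp_vec_sums[of A y] by (simp add: sm.scaleR_left divide_inverse)
  moreover have "(\<lambda>k. (c ^ k /\<^sub>R fact k) *s y) sums (exp c *s y)"
    by (rule sm.bounded_linear_left[THEN bounded_linear.sums, OF exp_converges])
  ultimately show ?thesis by (rule sums_unique2)
qed

text \<open>Nilpotency on the single vector \<open>y\<close> cuts the series after the quadratic
  term, which makes orbits of N explicit.\<close>

lemma mat_exp_nilpotent3:
  fixes A :: "complex ^ 'i::finite ^ 'i"
  assumes "A *v (A *v (A *v y)) = 0"
  shows "mat_exp A *v y = y + A *v y + (1 / 2) *\<^sub>R (A *v (A *v y))"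
proof -
  have "mat_pow A (3 + k) *v y = 0" for k
  proof -
    have "mat_pow A (3 + k) = mat_pow A k ** A ** A ** A"
      by (simp add: numeral_3_eq_3 mat_pow_Suc mat_pow_commute matrix_mul_assoc[symmetric])
    then show ?thesis
      by (simp add: matrix_vector_mul_assoc[symmetric] assms)
  qed
  then have "mat_pow A k *v y = 0" if "k \<notin> {..<3}" for k
    using that by (metis le_add_diff_inverse lessThan_iff not_le_imp_less)
  then have "(\<lambda>k. (1 / fact k) *\<^sub>R (mat_pow A k *v y)) sums (\<Sum>k<3. (1 / fact k) *\<^sub>R (mat_pow A k *v y))"
    by (intro sums_finite) auto
  from sums_unique2[OF mat_exp_vec_sums this] show ?thesis
    by (simp add: eval_nat_numeral mat_pow_Suc matrix_vector_mul_assoc[symmetric])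
qed

section \<open>Smooth maps\<close>

text \<open>Openness of \<open>S\<close> lets the equality pass to the derivatives, which are taken
  \<open>at x\<close> and so depend on a full neighbourhood.\<close>

lemma Ck_on_cong:
  assumes "open S" and "\<And>x. x \<in> S \<Longrightarrow> f x = g x" and "Ck_on k S f"
  shows "Ck_on k S g"
  using assms(2,3)
proof (induction k arbitrary: f g)
  case 0
  then show ?case using continuous_on_cong[of S S f g] by simp
next
  case (Suc k)
  have der: "(g has_derivative frechet_derivative f (at x)) (at x)" if "x \<in> S" for x
  proof (rule has_derivative_transform_within_open[OF _ \<open>open S\<close> that])
    have "f differentiable at x"
      using Suc.prems(2) that \<open>open S\<close> by (simp add: differentiable_on_eq_differentiable_at)
    then show "(f has_derivative frechet_derivative f (at x)) (at x)"
      by (simp add: frechet_derivative_works)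
  qed (use Suc.prems(1) in auto)
  then have "g differentiable_on S"
    by (meson differentiable_at_imp_differentiable_on differentiableI)
  moreover have "Ck_on k S (\<lambda>x. frechet_derivative g (at x) v)" for v
    using Suc.IH[of "\<lambda>x. frechet_derivative f (at x) v" "\<lambda>x. frechet_derivative g (at x) v"] Suc.prems(2)
      frechet_derivative_at[OF der] by simp
  ultimately show ?case by simp
qed

text \<open>Lets the inductions work with a closed formula \<open>f'\<close> in place of
  \<open>frechet_derivative\<close>.\<close>

lemma Ck_on_SucI:
  assumes "open S" and "\<And>x. x \<in> S \<Longrightarrow> (f has_derivative f' x) (at x)"
    and "\<And>v. Ck_on k S (\<lambda>x. f' x v)"
  shows "Ck_on (Suc k) S f"
proof -
  have "f differentiable_on S"
    using assms(2) by (meson differentiable_at_imp_differentiable_on differentiableI)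
  moreover have "Ck_on k S (\<lambda>x. frechet_derivative f (at x) v)" for v
    by (rule Ck_on_cong[OF assms(1) _ assms(3)[of v]]) (simp add: frechet_derivative_at[OF assms(2), symmetric])
  ultimately show ?thesis by simp
qed

lemma Ck_on_SucD:
  assumes "open S" and "Ck_on (Suc k) S f"
  shows "x \<in> S \<Longrightarrow> (f has_derivative frechet_derivative f (at x)) (at x)"
    and "Ck_on k S (\<lambda>x. frechet_derivative f (at x) v)"
  using assms by (auto simp: differentiable_on_eq_differentiable_at frechet_derivative_works)

lemma Ck_on_Suc_imp: "Ck_on (Suc k) S f \<Longrightarrow> Ck_on k S f"
  by (induction k arbitrary: f) (auto intro: differentiable_imp_continuous_on)

lemma Ck_on_const: "open S \<Longrightarrow> Ck_on k S (\<lambda>x. c)"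
proof (induction k arbitrary: c)
  case (Suc k)
  show ?case by (rule Ck_on_SucI[OF Suc.prems has_derivative_const Suc.IH[OF Suc.prems]])
qed simp

lemma Ck_on_bounded_linear:
  assumes "open S" and "bounded_linear f"
  shows "Ck_on k S f"
proof (cases k)
  case 0
  then show ?thesis using assms(2) by (simp add: linear_continuous_on)
next
  case (Suc l)
  then show ?thesis
    using Ck_on_SucI[OF assms(1) bounded_linear_imp_has_derivative[OF assms(2)] Ck_on_const[OF assms(1)]]
    by simp
qed

lemma Ck_on_add:
  assumes "open S"
  shows "Ck_on k S f \<Longrightarrow> Ck_on k S g \<Longrightarrow> Ck_on k S (\<lambda>x. f x + g x)"
proof (induction k arbitrary: f g)
  case 0
  then show ?case by (simp add: continuous_on_add)
next
  case (Suc k)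
  note D = Ck_on_SucD[OF assms]
  show ?case
    by (rule Ck_on_SucI[OF assms has_derivative_add[OF D(1)[OF Suc.prems(1)] D(1)[OF Suc.prems(2)]]
          Suc.IH[OF D(2)[OF Suc.prems(1)] D(2)[OF Suc.prems(2)]]])
qed

text \<open>One induction on the Leibniz rule serves complex multiplication, \<open>cdot\<close> and
  \<open>*s\<close> alike.\<close>

lemma (in bounded_bilinear) Ck_on:
  assumes "open S"
  shows "Ck_on k S f \<Longrightarrow> Ck_on k S g \<Longrightarrow> Ck_on k S (\<lambda>x. prod (f x) (g x))"
proof (induction k arbitrary: f g)
  case 0
  then show ?case by (simp add: continuous_on)
next
  case (Suc k)
  note D = Ck_on_SucD[OF assms]
  have "Ck_on k S f" "Ck_on k S g"
    using Suc.prems Ck_on_Suc_imp by blast+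
  then show ?case
    by (intro Ck_on_SucI[OF assms FDERIV[OF D(1)[OF Suc.prems(1)] D(1)[OF Suc.prems(2)]]]
          Ck_on_add[OF assms] Suc.IH D(2)[OF Suc.prems(1)] D(2)[OF Suc.prems(2)]) auto
qed

lemma Ck_on_inverse:
  fixes f :: "'a::real_normed_vector \<Rightarrow> 'b::real_normed_field"
  assumes "open S" and "\<And>x. x \<in> S \<Longrightarrow> f x \<noteq> 0"
  shows "Ck_on k S f \<Longrightarrow> Ck_on k S (\<lambda>x. inverse (f x))"
proof (induction k)
  case 0
  then show ?case using assms(2) by (auto intro: continuous_on_inverse)
next
  case (Suc k)
  note D = Ck_on_SucD[OF assms(1) Suc.prems]
  \<comment> \<open>The derivative of the inverse contains the inverse itself, so the claim of order
    k is used for the same \<open>f\<close>.\<close>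
  have IH: "Ck_on k S (\<lambda>x. inverse (f x))"
    using Suc.IH Suc.prems Ck_on_Suc_imp by blast
  have "Ck_on k S (\<lambda>x. (- 1) * (inverse (f x) * frechet_derivative f (at x) v * inverse (f x)))" for v
    by (intro bounded_bilinear.Ck_on[OF bounded_bilinear_mult assms(1)] Ck_on_const[OF assms(1)] IH D(2))
  then show ?case
    by (intro Ck_on_SucI[OF assms(1) Deriv.has_derivative_inverse[OF assms(2) D(1)]]) auto
qed

section \<open>The ball model and a field invariant under the stabilizer of an ideal point\<close>

definition cdot :: "complex ^ 'i::finite \<Rightarrow> complex ^ 'i \<Rightarrow> complex" where
  "cdot v w = (\<Sum>i\<in>UNIV. v $ i * cnj (w $ i))"

lemma bounded_bilinear_cdot: "bounded_bilinear (cdot :: complex ^ 'i::finite \<Rightarrow> complex ^ 'i \<Rightarrow> complex)"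
  unfolding bilinear_conv_bounded_bilinear[symmetric] bilinear_def
  by (auto intro!: linearI simp: cdot_def algebra_simps sum.distrib scaleR_sum_right)

interpretation cdot: bounded_bilinear "cdot :: complex ^ 'i::finite \<Rightarrow> complex ^ 'i \<Rightarrow> complex"
  by (rule bounded_bilinear_cdot)

lemma cdot_smult_left: "cdot (c *s v) w = c * cdot v w"
  and cdot_smult_right: "cdot v (c *s w) = cnj c * cdot v w"
  and cnj_cdot: "cnj (cdot v w) = cdot w v"
  by (simp_all add: cdot_def sum_distrib_left mult_ac)

lemma Re_cdot: "Re (cdot v w) = v \<bullet> w"
  by (simp add: cdot_def inner_vec_def inner_complex_def)

lemma cdot_self: "cdot v v = of_real ((norm v)\<^sup>2)"
  by (rule complex_eqI) (simp_all add: Re_cdot power2_norm_eq_inner, simp add: cdot_def algebra_simps)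

lemma norm_smult: "norm (c *s v) = norm c * norm v"
  for v :: "complex ^ 'i::finite"
  by (simp add: norm_vec_def norm_mult L2_set_right_distrib)

lemma cdot_adjoint: "cdot v (A *v w) = cdot (conj_transpose A *v v) w"
  for A :: "complex ^ 'i::finite ^ 'j::finite"
proof -
  have "cdot v (A *v w) = (\<Sum>j\<in>UNIV. \<Sum>i\<in>UNIV. v $ j * cnj (A $ j $ i) * cnj (w $ i))"
    by (simp add: cdot_def matrix_vector_mult_def sum_distrib_left mult_ac)
  also have "\<dots> = cdot (conj_transpose A *v v) w"
    by (subst sum.swap) (simp add: cdot_def matrix_vector_mult_def conj_transpose_def sum_distrib_right sum_distrib_left mult_ac)
  finally show ?thesis .
qed

lemma sum_option: "(\<Sum>i\<in>UNIV. f i) = f None + (\<Sum>i\<in>UNIV. f (Some i))"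
  for f :: "'n::finite option \<Rightarrow> 'a::comm_monoid_add"
  by (simp add: UNIV_option_conv sum.reindex)

lemma vec_option_eq_iff: "v = w \<longleftrightarrow> v $ None = w $ None \<and> (\<forall>i. v $ Some i = w $ Some i)"
  by (auto simp: vec_eq_iff split_option_all)

definition space_part :: "complex ^ 'n::finite option \<Rightarrow> complex ^ 'n" where
  "space_part y = (\<chi> i. y $ Some i)"

lemma space_part_nth [simp]: "space_part y $ i = y $ Some i"
  by (simp add: space_part_def)

lemma bounded_linear_space_part: "bounded_linear (space_part :: complex ^ 'n::finite option \<Rightarrow> complex ^ 'n)"
  unfolding linear_conv_bounded_linear[symmetric] by (auto intro!: linearI simp: vec_eq_iff)

lemma space_part_diff: "space_part (y - z) = space_part y - space_part z"
  by (simp add: vec_eq_iff)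

lemma space_part_smult: "space_part (c *s y) = c *s space_part y"
  by (simp add: vec_eq_iff)

lemma lift_nth [simp]: "lift z $ None = 1" "lift z $ Some i = z $ i"
  by (simp_all add: lift_def)

lemma space_part_lift [simp]: "space_part (lift z) = z"
  by (simp add: vec_eq_iff)

text \<open>The form of \<open>form_matrix\<close>, split along its negative direction:
  \<open>z\<close> lies in the ball exactly when \<open>lift z\<close> is negative for it.\<close>

definition herm :: "complex ^ 'n::finite option \<Rightarrow> complex ^ 'n option \<Rightarrow> complex" where
  "herm v w = cdot (space_part v) (space_part w) - v $ None * cnj (w $ None)"

lemma herm_form_matrix: "herm v w = cdot (form_matrix *v v) w"
proof -
  have "(form_matrix *v v) $ i = (if i = None then - v $ None else v $ i)" for i
  proof -
    have "(form_matrix *v v) $ i = (\<Sum>j\<in>UNIV. if i = j then (if i = None then - v $ j else v $ j) else 0)"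
      unfolding matrix_vector_mult_def form_matrix_def vec_lambda_beta by (rule sum.cong) auto
    then show ?thesis by (simp add: sum.delta)
  qed
  then show ?thesis by (simp add: herm_def cdot_def sum_option)
qed

lemma bounded_bilinear_herm: "bounded_bilinear (herm :: complex ^ 'n::finite option \<Rightarrow> complex ^ 'n option \<Rightarrow> complex)"
  unfolding bilinear_conv_bounded_bilinear[symmetric] bilinear_def herm_form_matrix[abs_def]
  by (auto intro!: linearI simp: mv.add_right mv.scaleR_right cdot.add_left cdot.add_right cdot.scaleR_left cdot.scaleR_right)

interpretation herm: bounded_bilinear "herm :: complex ^ 'n::finite option \<Rightarrow> complex ^ 'n option \<Rightarrow> complex"
  by (rule bounded_bilinear_herm)

lemma herm_smult_left: "herm (c *s v) w = c * herm v w"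
  and herm_smult_right: "herm v (c *s w) = cnj c * herm v w"
  and cnj_herm: "cnj (herm v w) = herm w v"
  by (simp_all add: herm_def space_part_smult cdot_smult_left cdot_smult_right cnj_cdot algebra_simps)

lemma herm_lift: "herm (lift z) (lift w) = cdot z w - 1"
  by (simp add: herm_def)

section \<open>Linear isometries of the form and their infinitesimal version\<close>

definition isometric :: "'n::finite cmat \<Rightarrow> bool" where
  "isometric g \<longleftrightarrow> (\<forall>v w. herm (g *v v) (g *v w) = herm v w)"

text \<open>\<open>isometric\<close> describes U(n,1) and \<open>skew\<close> its Lie algebra.
  Testing on vectors suits the geometric arguments, which follow single vectors such as
  \<open>lift u\<close>.\<close>

definition skew :: "'n::finite cmat \<Rightarrow> bool" where
  "skew X \<longleftrightarrow> (\<forall>v w. herm (X *v v) w + herm v (X *v w) = 0)"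

lemma isometric_SUn1: "g \<in> SUn1 \<Longrightarrow> isometric g"
  by (simp add: SUn1_def isometric_def herm_form_matrix cdot_adjoint matrix_vector_mul_assoc matrix_mul_assoc)

text \<open>The bridge between the matrix equation defining \<open>su_n1\<close> and skewness tested
  on vectors.\<close>

lemma herm_skew_defect:
  "herm (X *v v) w + herm v (X *v w) = cdot ((conj_transpose X ** form_matrix + form_matrix ** X) *v v) w"
  by (simp add: herm_form_matrix cdot_adjoint matrix_vector_mul_assoc mv.add_left cdot.add_left)

lemma isometric_mult: "isometric g \<Longrightarrow> isometric h \<Longrightarrow> isometric (g ** h)"
  by (simp add: isometric_def matrix_vector_mul_assoc[symmetric])

lemma isometric_left_inverse:
  assumes "isometric g" and "g ** h = mat 1"
  shows "isometric h"
  unfolding isometric_def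
proof (intro allI)
  fix v w
  have "herm (h *v v) (h *v w) = herm (g *v (h *v v)) (g *v (h *v w))"
    using assms(1) by (simp add: isometric_def)
  then show "herm (h *v v) (h *v w) = herm v w"
    by (simp add: matrix_vector_mul_assoc assms(2))
qed

lemma isometric_mat_exp:
  assumes "skew X"
  shows "isometric (mat_exp (t *\<^sub>R X))"
  unfolding isometric_def
proof (intro allI)
  fix v w
  let ?v = "\<lambda>t. mat_exp (t *\<^sub>R X) *v v" and ?w = "\<lambda>t. mat_exp (t *\<^sub>R X) *v w"
  have "((\<lambda>t. herm (?v t) (?w t)) has_vector_derivative 0) (at t)" for t
    using herm.has_vector_derivative[OF mat_exp_vec_has_vector_derivative[of X v t]
        mat_exp_vec_has_vector_derivative[of X w t]] assms
    by (simp add: skew_def add.commute)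
  from has_vector_derivative_zero_imp_const[OF this, of t 0]
  show "herm (?v t) (?w t) = herm v w" by simp
qed

text \<open>Differentiates the invariance of the form at time 0. It serves for velocities known only
  through their one-parameter groups, such as those in F.\<close>

lemma skew_if_isometric_mat_exp:
  assumes "\<And>t. isometric (mat_exp (t *\<^sub>R X))"
  shows "skew X"
  unfolding skew_def
proof (intro allI)
  fix v w
  let ?v = "\<lambda>t. mat_exp (t *\<^sub>R X) *v v" and ?w = "\<lambda>t. mat_exp (t *\<^sub>R X) *v w"
  have "((\<lambda>t. herm (?v t) (?w t)) has_vector_derivative (herm (X *v v) w + herm v (X *v w))) (at 0)"
    using herm.has_vector_derivative[OF mat_exp_vec_has_vector_derivative[of X v 0]
        mat_exp_vec_has_vector_derivative[of X w 0]] by (simp add: add.commute)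
  moreover have "herm (?v t) (?w t) = herm v w" for t
    using assms by (simp add: isometric_def)
  ultimately show "herm (X *v v) w + herm v (X *v w) = 0"
    by (auto intro: vector_derivative_unique_at[OF _ has_vector_derivative_const])
qed

section \<open>The action on the ball and its differential\<close>

lemma isometric_None_nonzero:
  assumes "isometric g" and "z \<in> CH"
  shows "(g *v lift z) $ None \<noteq> 0"
    and "act g z \<in> CH"
    and "lift (act g z) = inverse ((g *v lift z) $ None) *s (g *v lift z)"
proof -
  let ?y = "g *v lift z"
  have nz: "norm z < 1" using assms(2) by (simp add: CH_def)
  \<comment> \<open>\<open>g\<close> keeps \<open>lift z\<close> negative, and the last coordinate
    of a negative vector is larger in modulus than its spatial part.\<close>
  have "herm ?y ?y = of_real ((norm z)\<^sup>2 - 1)"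
    using assms(1) by (simp add: isometric_def herm_lift cdot_self)
  moreover have "herm ?y ?y = of_real ((norm (space_part ?y))\<^sup>2 - (norm (?y $ None))\<^sup>2)"
    by (simp only: herm_def cdot_self complex_norm_square of_real_diff)
  ultimately have eq: "(norm (space_part ?y))\<^sup>2 - (norm (?y $ None))\<^sup>2 = (norm z)\<^sup>2 - 1"
    by (metis of_real_eq_iff)
  moreover have "(norm z)\<^sup>2 < 1" using nz by (simp add: power_less_one_iff)
  ultimately have less: "(norm (space_part ?y))\<^sup>2 < (norm (?y $ None))\<^sup>2" by simp
  then show ne: "?y $ None \<noteq> 0" using zero_le_power2[of "norm (space_part ?y)"] by auto
  show l: "lift (act g z) = inverse (?y $ None) *s ?y"
    using ne by (simp add: vec_option_eq_iff act_def field_simps)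
  have "act g z = inverse (?y $ None) *s space_part ?y"
    by (simp add: vec_eq_iff act_def field_simps)
  then have "norm (act g z) = norm (space_part ?y) / norm (?y $ None)"
    by (simp add: norm_smult norm_inverse divide_inverse mult.commute)
  moreover have "norm (space_part ?y) < norm (?y $ None)"
    using less by (simp add: power2_less_imp_less)
  ultimately show "act g z \<in> CH" using ne by (simp add: CH_def)
qed

lemma act_eqI: "g *v lift z = c *s lift w \<Longrightarrow> c \<noteq> 0 \<Longrightarrow> act g z = w"
  by (simp add: act_def vec_eq_iff)

lemma act_mult:
  assumes "isometric h" and "isometric g" and "z \<in> CH"
  shows "act (g ** h) z = act g (act h z)"
proof -
  note h = isometric_None_nonzero[OF assms(1,3)] and g = isometric_None_nonzero[OF assms(2)]
  have "(g ** h) *v lift z = g *v ((h *v lift z) $ None *s lift (act h z))"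
    using h by (simp add: matrix_vector_mul_assoc)
  also have "\<dots> = (h *v lift z) $ None *s (g *v lift (act h z))"
    by (rule matrix_vector_mult_smult)
  also have "\<dots> = ((h *v lift z) $ None * (g *v lift (act h z)) $ None) *s lift (act g (act h z))"
    using g[OF h(2)] by simp
  finally show ?thesis by (rule act_eqI) (use h g[OF h(2)] in simp)
qed

text \<open>The differential at \<open>lift z\<close> of the projection from homogeneous coordinates
  to the chart; its kernel is the line of \<open>lift z\<close>.\<close>

definition tangent :: "complex ^ 'n::finite \<Rightarrow> complex ^ 'n option \<Rightarrow> complex ^ 'n" where
  "tangent z y = space_part y - y $ None *s z"

lemma tangent_smult: "tangent z (c *s y) = c *s tangent z y"
  by (simp add: tangent_def vec_eq_iff algebra_simps)

text \<open>\<open>lift w - lift 0\<close> is \<open>(w, 0)\<close>.\<close>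

lemma lift_minus_lift_0: "lift (tangent z y) - lift 0 = y - y $ None *s lift z"
  by (simp add: vec_option_eq_iff tangent_def)

lemma lift_has_derivative: "(lift has_derivative (\<lambda>v. lift v - lift 0)) (at z)"
proof -
  have "bounded_linear (\<lambda>v. lift v - lift 0 :: complex ^ 'a option)"
    unfolding linear_conv_bounded_linear[symmetric]
    by (auto intro!: linearI simp: vec_option_eq_iff)
  then have "((\<lambda>v. (lift v - lift 0) + lift 0) has_derivative (\<lambda>v. (lift v - lift 0) + 0)) (at z)"
    by (intro has_derivative_add bounded_linear_imp_has_derivative has_derivative_const)
  then show ?thesis by simp
qed

lemma act_has_derivative:
  assumes "(g *v lift z) $ None \<noteq> 0"
  shows "(act g has_derivative (\<lambda>v. inverse ((g *v lift z) $ None) *s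
           tangent (act g z) (g *v (lift v - lift 0)))) (at z)"
proof -
  let ?q = "\<lambda>z. (g *v lift z) $ None" and ?y = "\<lambda>z. g *v lift z"
  have y: "(?y has_derivative (\<lambda>v. g *v (lift v - lift 0))) (at z)"
    by (rule bounded_linear.has_derivative[OF mv.bounded_linear_right lift_has_derivative])
  have s: "((\<lambda>z. space_part (?y z)) has_derivative (\<lambda>v. space_part (g *v (lift v - lift 0)))) (at z)"
    by (rule bounded_linear.has_derivative[OF bounded_linear_space_part y])
  have q: "(?q has_derivative (\<lambda>v. (g *v (lift v - lift 0)) $ None)) (at z)"
    by (rule bounded_linear.has_derivative[OF bounded_linear_vec_nth y])
  have act: "act g = (\<lambda>z. inverse (?q z) *s space_part (?y z))"
    by (simp add: fun_eq_iff vec_eq_iff act_def divide_inverse mult.commute)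
  show ?thesis
    unfolding act
    by (rule has_derivative_eq_rhs[OF sm.FDERIV[OF Deriv.has_derivative_inverse[OF assms q] s]])
       (simp add: fun_eq_iff vec_eq_iff tangent_def algebra_simps)
qed

lemma dact_eq:
  assumes "(g *v lift z) $ None \<noteq> 0"
  shows "dact g z v = inverse ((g *v lift z) $ None) *s tangent (act g z) (g *v (lift v - lift 0))"
  unfolding dact_def using frechet_derivative_at[OF act_has_derivative[OF assms]] by metis

text \<open>Projecting commutes with \<open>g\<close> up to scale: the factor rescales
  \<open>g *v lift z\<close> to last coordinate 1.\<close>

lemma dact_tangent:
  assumes "isometric g" and "z \<in> CH"
  shows "dact g z (tangent z y) = inverse ((g *v lift z) $ None) *s tangent (act g z) (g *v y)"
proof -
  note g = isometric_None_nonzero[OF assms]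
  \<comment> \<open>\<open>tangent\<close> kills the line of its base point, so the correction along
    \<open>lift z\<close> from \<open>lift_minus_lift_0\<close> disappears after applying
    \<open>g\<close>.\<close>
  have "tangent (act g z) (g *v lift z) = 0"
    using g(1) by (simp add: tangent_def vec_eq_iff act_def)
  then have "tangent (act g z) (g *v (y - y $ None *s lift z)) = tangent (act g z) (g *v y)"
    by (simp add: tangent_def mv.diff_right matrix_vector_mult_smult vec_eq_iff algebra_simps)
  then show ?thesis
    by (simp add: dact_eq[OF g(1)] lift_minus_lift_0)
qed

text \<open>The action is holomorphic. Hence complex multiples of an invariant field are invariant,
  which yields the second field.\<close>

lemma dact_smult:
  assumes "isometric g" and "z \<in> CH"
  shows "dact g z (c *s v) = c *s dact g z v"
proof -
  have "lift (c *s v) - lift 0 = c *s (lift v - lift 0)" by (simp add: vec_option_eq_iff)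
  then show ?thesis
    by (simp only: dact_eq[OF isometric_None_nonzero(1)[OF assms]] matrix_vector_mult_smult tangent_smult
        vector_smult_assoc mult.commute)
qed

lemma surj_dact:
  assumes "isometric g" and "g ** h = mat 1" and "z \<in> CH"
  obtains w where "dact g z w = v"
proof
  let ?q = "(g *v lift z) $ None"
  \<comment> \<open>The witness pulls \<open>(v, 0)\<close> back by the right inverse and
    compensates for the factor \<open>inverse ?q\<close>.\<close>
  have "dact g z (tangent z (?q *s (h *v (lift v - lift 0))))
      = inverse ?q *s tangent (act g z) (?q *s (lift v - lift 0))"
    unfolding dact_tangent[OF assms(1,3)]
    by (simp add: matrix_vector_mult_smult matrix_vector_mul_assoc assms(2))
  also have "\<dots> = v"
    using isometric_None_nonzero(1)[OF assms(1,3)] by (simp add: tangent_def vec_eq_iff)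
  finally show "dact g z (tangent z (?q *s (h *v (lift v - lift 0)))) = v" .
qed

text \<open>Invariantly, the line spanned by \<open>y\<close> is moved in the direction
  \<open>(herm y y / herm (lift u) y) *s lift u\<close>, which is equivariant under the scaling of \<open>y\<close> and
  independent of the scaling of \<open>lift u\<close>.\<close>

definition horo_field :: "complex ^ 'n::finite \<Rightarrow> complex ^ 'n \<Rightarrow> complex ^ 'n" where
  "horo_field u z = (of_real (1 - (norm z)\<^sup>2) / (1 - cdot u z)) *s (u - z)"

section \<open>The invariant field: non-vanishing, invariance and smoothness\<close>

lemma one_minus_cdot_nonzero: "norm u = 1 \<Longrightarrow> z \<in> CH \<Longrightarrow> 1 - cdot u z \<noteq> 0"
proof
  assume "norm u = 1" "z \<in> CH" "1 - cdot u z = 0"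
  then have "u \<bullet> z = 1" using Re_cdot[of u z] by simp
  moreover have "u \<bullet> z \<le> norm u * norm z" by (rule norm_cauchy_schwarz)
  ultimately show False using \<open>norm u = 1\<close> \<open>z \<in> CH\<close> by (simp add: CH_def)
qed

lemma horo_field_0 [simp]: "horo_field u 0 = u"
  by (simp add: horo_field_def cdot.zero_right)

lemma horo_field_nonzero: "norm u = 1 \<Longrightarrow> z \<in> CH \<Longrightarrow> horo_field u z \<noteq> 0"
proof -
  assume u: "norm u = 1" and z: "z \<in> CH"
  then have "norm z < 1" "u - z \<noteq> 0" by (auto simp: CH_def)
  moreover have "(norm z)\<^sup>2 \<noteq> 1"
    using \<open>norm z < 1\<close> by (metis norm_ge_zero order_less_irrefl power2_eq_1_iff abs_of_nonneg abs_norm_cancel real_sqrt_abs real_sqrt_one)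
  ultimately show ?thesis
    using one_minus_cdot_nonzero[OF u z] by (simp add: horo_field_def of_real_eq_1_iff del: of_real_power)
qed

text \<open>Numerator and denominator both change sign, which cancels. In this form the effect of an
  isometry can be read off.\<close>

lemma horo_field_herm:
  "horo_field u z = (herm (lift z) (lift z) / herm (lift u) (lift z)) *s tangent z (lift u)"
proof -
  have "of_real (1 - (norm z)\<^sup>2) / (1 - cdot u z) = (cdot z z - 1) / (cdot u z - 1)"
    using minus_divide_divide[of "cdot z z - 1" "cdot u z - 1"] by (simp add: cdot_self)
  then show ?thesis by (simp add: horo_field_def herm_lift tangent_def)
qed

text \<open>Under \<open>g\<close> the quotient of the forms is multiplied by
  \<open>\<kappa> / q\<close>, where \<open>q\<close> is the last coordinate of
  \<open>g *v lift z\<close>; by \<open>dact_tangent\<close> the differential produces the same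
  factor on \<open>tangent\<close>.\<close>

lemma horo_field_invariant:
  assumes g: "isometric g" and \<kappa>: "g *v lift u = \<kappa> *s lift u" and u: "norm u = 1" and z: "z \<in> CH"
  shows "dact g z (horo_field u z) = horo_field u (act g z)"
proof -
  note gz = isometric_None_nonzero[OF g z]
  let ?q = "(g *v lift z) $ None" and ?a = "herm (lift z) (lift z)" and ?b = "herm (lift u) (lift z)"
  have b: "?b \<noteq> 0" using one_minus_cdot_nonzero[OF u z] by (simp add: herm_lift)
  have eq: "\<kappa> * herm (lift u) (g *v lift z) = ?b"
    using g unfolding isometric_def by (metis \<kappa> herm_smult_left)
  then have \<kappa>0: "\<kappa> \<noteq> 0" using b by auto
  have "herm (lift (act g z)) (lift (act g z)) = inverse ?q * inverse (cnj ?q) * ?a"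
    using g by (simp add: gz(3) herm_smult_left herm_smult_right isometric_def)
  moreover have "herm (lift u) (lift (act g z)) = inverse (cnj ?q) * (?b / \<kappa>)"
    using \<kappa>0 by (simp add: gz(3) herm_smult_right eq[symmetric])
  ultimately have "herm (lift (act g z)) (lift (act g z)) / herm (lift u) (lift (act g z)) = ?a / ?b * inverse ?q * \<kappa>"
    using gz(1) \<kappa>0 b by (simp only: complex_cnj_zero_iff) (simp add: divide_simps)
  moreover have "dact g z (horo_field u z) = (?a / ?b) *s (inverse ?q *s (\<kappa> *s tangent (act g z) (lift u)))"
    by (simp only: horo_field_herm dact_smult[OF g z] dact_tangent[OF g z] \<kappa> tangent_smult)
  ultimately show ?thesis by (simp add: horo_field_herm[of u "act g z"])
qed

lemma smooth_on_horo_field: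
  assumes u: "norm u = 1"
  shows "smooth_on CH (horo_field u)"
  unfolding smooth_on_def
proof
  fix k
  have S: "open (CH :: (complex ^ 'a) set)" by (simp add: CH_def)
  note const = Ck_on_const[OF S] and add = Ck_on_add[OF S] and lin = Ck_on_bounded_linear[OF S]
    and mult = bounded_bilinear.Ck_on[OF bounded_bilinear_mult S]
  have neg: "Ck_on k CH (\<lambda>z :: complex ^ 'a. (- 1) *\<^sub>R z)"
    by (intro lin bounded_linear_scaleR_right)
  have "Ck_on k CH (\<lambda>z :: complex ^ 'a. cdot ((- 1) *\<^sub>R z) z)"
    by (rule cdot.Ck_on[OF S neg lin[OF bounded_linear_ident]])
  moreover have "Ck_on k CH (\<lambda>z. cdot (- u) z)"
    by (rule lin[OF cdot.bounded_linear_right])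
  \<comment> \<open>The same formula assembled from sums, products and one inverse; pairing
    \<open>- z\<close> with \<open>z\<close> stands for \<open>- (norm z)\<^sup>2\<close>.\<close>
  ultimately have "Ck_on k CH (\<lambda>z. ((1 + cdot ((- 1) *\<^sub>R z) z) * inverse (1 + cdot (- u) z)) *s (u + (- 1) *\<^sub>R z))"
    using one_minus_cdot_nonzero[OF u]
    by (intro sm.Ck_on[OF S] mult Ck_on_inverse[OF S] add const neg lin[OF bounded_linear_ident]) (auto simp: cdot.minus_left)
  then show "Ck_on k CH (horo_field u)"
    by (rule Ck_on_cong[OF S, rotated])
       (simp add: horo_field_def cdot.minus_left cdot_self divide_inverse)
qed

lemma smooth_on_smult: "smooth_on CH Y \<Longrightarrow> smooth_on CH (\<lambda>z. c *s Y z)"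
  for Y :: "complex ^ 'n::finite \<Rightarrow> complex ^ 'n"
  using sm.Ck_on[of CH _ "\<lambda>_. c" Y] Ck_on_const[of CH] by (auto simp: smooth_on_def CH_def)

section \<open>One-parameter subgroups of closed matrix groups\<close>

text \<open>Powers close to the identity are estimated in the operator norm, because \<open>norm\<close> is the
  Frobenius norm and gives the identity matrix norm greater than \<open>1\<close>.\<close>

definition opnorm :: "complex ^ 'k::finite ^ 'i::finite \<Rightarrow> real" where
  "opnorm A = onorm ((*v) A)"

lemma norm_le_opnorm_mult: "norm (A *v y) \<le> opnorm A * norm y"
  unfolding opnorm_def by (rule onorm[OF mv.bounded_linear_right])

lemma opnorm_bound: "(\<And>y. norm (A *v y) \<le> b * norm y) \<Longrightarrow> opnorm A \<le> b"
  unfolding opnorm_def by (rule onorm_le)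

lemma opnorm_nonneg: "0 \<le> opnorm A"
  unfolding opnorm_def by (rule onorm_pos_le[OF mv.bounded_linear_right])

lemma opnorm_one_le: "opnorm (mat 1 :: complex ^ 'i::finite ^ 'i) \<le> 1"
  by (rule opnorm_bound) simp

lemma opnorm_mult: "opnorm (A ** B) \<le> opnorm A * opnorm B"
proof (rule opnorm_bound)
  fix y
  have "norm ((A ** B) *v y) \<le> opnorm A * norm (B *v y)"
    unfolding matrix_vector_mul_assoc[symmetric] by (rule norm_le_opnorm_mult)
  also have "\<dots> \<le> opnorm A * (opnorm B * norm y)"
    by (intro mult_left_mono norm_le_opnorm_mult opnorm_nonneg)
  finally show "norm ((A ** B) *v y) \<le> opnorm A * opnorm B * norm y" by simp
qed

lemma opnorm_add: "opnorm (A + B) \<le> opnorm A + opnorm B"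
proof (rule opnorm_bound)
  fix y
  have "norm ((A + B) *v y) \<le> norm (A *v y) + norm (B *v y)"
    unfolding mv.add_left by (rule norm_triangle_ineq)
  also have "\<dots> \<le> opnorm A * norm y + opnorm B * norm y"
    by (intro add_mono norm_le_opnorm_mult)
  finally show "norm ((A + B) *v y) \<le> (opnorm A + opnorm B) * norm y" by (simp add: algebra_simps)
qed

lemma opnorm_le_norm: "\<exists>K>0. \<forall>A :: complex ^ 'k::finite ^ 'i::finite. opnorm A \<le> K * norm A"
proof -
  obtain K where "K > 0" "\<And>(A :: complex ^ 'k ^ 'i) y. norm (A *v y) \<le> norm A * norm y * K"
    using mv.pos_bounded by blast
  then have "opnorm A \<le> K * norm A" for A :: "complex ^ 'k ^ 'i"
    by (intro opnorm_bound) (simp add: mult_ac)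
  with \<open>K > 0\<close> show ?thesis by blast
qed

text \<open>With \<open>opnorm_le_norm\<close> this is an equivalence of norms: limits enter and
  leave in \<open>norm\<close>, powers are estimated in between.\<close>

lemma norm_le_opnorm: "norm A \<le> real (CARD('i) * CARD('k)) * opnorm A"
  for A :: "complex ^ 'k::finite ^ 'i::finite"
proof -
  have "norm (A $ i $ j) \<le> opnorm A" for i j
  proof -
    have "(A *v axis j 1) $ i = A $ i $ j"
      by (simp add: matrix_vector_mult_def axis_def if_distrib cong: if_cong)
    then have "norm (A $ i $ j) \<le> norm (A *v axis j 1)"
      using Finite_Cartesian_Product.norm_nth_le[of "A *v axis j 1" i] by simp
    also have "\<dots> \<le> opnorm A" using norm_le_opnorm_mult[of A "axis j 1"] by simp
    finally show ?thesis .
  qed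
  then have "norm (A $ i) \<le> (\<Sum>j\<in>(UNIV :: 'k set). opnorm A)" for i
    unfolding norm_vec_def by (intro order_trans[OF L2_set_le_sum] sum_mono) auto
  then have "norm A \<le> (\<Sum>i\<in>(UNIV :: 'i set). \<Sum>j\<in>(UNIV :: 'k set). opnorm A)"
    unfolding norm_vec_def[of A] by (intro order_trans[OF L2_set_le_sum] sum_mono) auto
  then show ?thesis by simp
qed

text \<open>Telescoping with powers of \<open>a\<close> in front and powers of \<open>b\<close>
  behind. In the application \<open>b\<close> is an exponential whose powers stay on a compact arc,
  which provides \<open>B\<close>.\<close>

lemma opnorm_mat_pow_diff:
  assumes a: "opnorm a \<le> 1 + c" and c: "0 \<le> c" and ab: "opnorm (a - b) \<le> \<delta>"
    and b: "\<And>j. j < m \<Longrightarrow> opnorm (mat_pow b j) \<le> B" and B: "0 \<le> B"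
  shows "opnorm (mat_pow a m - mat_pow b m) \<le> real m * \<delta> * B * (1 + c) ^ m"
  using b
proof (induction m)
  case 0
  show ?case by (rule opnorm_bound) simp
next
  case (Suc m)
  have \<delta>: "0 \<le> \<delta>" using ab opnorm_nonneg order_trans by blast
  have "mat_pow a (Suc m) - mat_pow b (Suc m) = a ** (mat_pow a m - mat_pow b m) + (a - b) ** mat_pow b m"
    by (simp add: mat_pow_Suc mm.diff_left mm.diff_right)
  then have "opnorm (mat_pow a (Suc m) - mat_pow b (Suc m))
      \<le> opnorm a * opnorm (mat_pow a m - mat_pow b m) + opnorm (a - b) * opnorm (mat_pow b m)"
    by (simp only: order_trans[OF opnorm_add add_mono[OF opnorm_mult opnorm_mult]])
  also have "\<dots> \<le> (1 + c) * (real m * \<delta> * B * (1 + c) ^ m) + \<delta> * B"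
    using a ab Suc c \<delta> B by (intro add_mono mult_mono) (auto simp: opnorm_nonneg)
  also have "\<delta> * B \<le> \<delta> * B * (1 + c) ^ Suc m"
    using mult_left_mono[OF one_le_power[of "1 + c" "Suc m"], of "\<delta> * B"] \<delta> B c by simp
  finally show ?case by (simp add: algebra_simps)
qed

lemma continuous_on_mat_exp: "continuous_on S (\<lambda>t. mat_exp (t *\<^sub>R A))"
  for A :: "complex ^ 'i::finite ^ 'i"
  by (rule continuous_at_imp_continuous_on)
     (blast intro: has_vector_derivative_continuous mat_exp_has_vector_derivative)

text \<open>The steps \<open>e k\<close> may have either sign; the closed subgroup argument also
  uses backward ones.\<close>

lemma mat_exp_difference_quotient:
  fixes A :: "complex ^ 'i::finite ^ 'i"
  assumes "(e \<longlongrightarrow> 0) net" and "\<forall>\<^sub>F k in net. e k \<noteq> 0"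
  shows "((\<lambda>k. (1 / e k) *\<^sub>R (mat_exp (e k *\<^sub>R A) - mat 1)) \<longlongrightarrow> A) net"
proof -
  have "((\<lambda>h. mat_exp (h *\<^sub>R A)) has_vector_derivative A) (at 0)"
    using mat_exp_has_vector_derivative[of A 0] by simp
  then have "((\<lambda>h. (mat_exp (h *\<^sub>R A) - mat 1 - h *\<^sub>R A) /\<^sub>R norm h) \<longlongrightarrow> 0) (at 0)"
    by (simp add: has_vector_derivative_def has_derivative_at_within)
  then have "((\<lambda>h. norm ((mat_exp (h *\<^sub>R A) - mat 1 - h *\<^sub>R A) /\<^sub>R norm h)) \<longlongrightarrow> 0) (at 0)"
    by (rule tendsto_norm_zero)
  moreover have "norm ((mat_exp (h *\<^sub>R A) - mat 1 - h *\<^sub>R A) /\<^sub>R norm h)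
      = norm ((1 / h) *\<^sub>R (mat_exp (h *\<^sub>R A) - mat 1) - A)" if "h \<noteq> 0" for h :: real
  proof -
    have "(1 / h) *\<^sub>R (mat_exp (h *\<^sub>R A) - mat 1) - A = (1 / h) *\<^sub>R (mat_exp (h *\<^sub>R A) - mat 1 - h *\<^sub>R A)"
      using that by (simp add: scaleR_diff_right)
    then show ?thesis by (simp add: divide_inverse)
  qed
  ultimately have "((\<lambda>h. norm ((1 / h) *\<^sub>R (mat_exp (h *\<^sub>R A) - mat 1) - A)) \<longlongrightarrow> 0) (at 0)"
    by (subst tendsto_cong[where g = "\<lambda>h. norm ((mat_exp (h *\<^sub>R A) - mat 1 - h *\<^sub>R A) /\<^sub>R norm h)"])
       (auto simp: eventually_at_filter)
  then have "((\<lambda>h. (1 / h) *\<^sub>R (mat_exp (h *\<^sub>R A) - mat 1)) \<longlongrightarrow> A) (at 0)"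
    using Lim_null tendsto_norm_zero_iff by blast
  moreover have "filterlim e (at 0) net"
    using assms by (simp add: filterlim_at)
  ultimately show ?thesis by (rule filterlim_compose)
qed

text \<open>\<open>g k\<close> and exp(e_k X) differ by o(e_k), and the number of steps is at most t
  / e_k, so the accumulated error tends to 0. The floor costs at most \<open>e k\<close> in total
  time.\<close>

lemma mat_pow_tendsto_mat_exp:
  fixes g :: "nat \<Rightarrow> complex ^ 'i::finite ^ 'i" and e :: "nat \<Rightarrow> real"
  assumes e: "\<And>k. e k > 0" "e \<longlonglongrightarrow> 0" and X: "(\<lambda>k. (1 / e k) *\<^sub>R (g k - mat 1)) \<longlonglongrightarrow> X"
    and t: "0 \<le> t"
  shows "(\<lambda>k. mat_pow (g k) (nat \<lfloor>t / e k\<rfloor>)) \<longlonglongrightarrow> mat_exp (t *\<^sub>R X)"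
proof -
  define m where "m k = nat \<lfloor>t / e k\<rfloor>" for k
  define E where "E k = mat_exp (e k *\<^sub>R X)" for k
  define Z where "Z k = (1 / e k) *\<^sub>R (g k - mat 1)" for k
  obtain K where K: "K > 0" "\<And>A :: complex ^ 'i ^ 'i. opnorm A \<le> K * norm A"
    using opnorm_le_norm by blast
  have me: "real (m k) * e k \<le> t" "t - e k \<le> real (m k) * e k" for k
  proof -
    have "real (m k) = of_int \<lfloor>t / e k\<rfloor>"
      using t e(1)[of k] by (simp add: m_def)
    then have "real (m k) \<le> t / e k" "t / e k \<le> real (m k) + 1" by linarith+
    then show "real (m k) * e k \<le> t" "t - e k \<le> real (m k) * e k"
      using e(1)[of k] by (simp_all add: field_simps)
  qed
  \<comment> \<open>The powers of \<open>E k\<close> up to \<open>m k\<close> are values of the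
    exponential on a compact interval, hence bounded uniformly in \<open>k\<close>.\<close>
  have "compact ((\<lambda>s. mat_exp (s *\<^sub>R X)) ` {0..t})"
    by (intro compact_continuous_image continuous_on_mat_exp) auto
  then obtain b where b: "\<And>s. s \<in> {0..t} \<Longrightarrow> norm (mat_exp (s *\<^sub>R X)) \<le> b"
    using compact_imp_bounded bounded_iff by (metis imageI)
  define B where "B = K * \<bar>b\<bar>"
  have B: "opnorm (mat_pow (E k) j) \<le> B" if "j < m k" for j k
  proof -
    have "real j * e k \<le> real (m k) * e k" using that e(1)[of k] by (intro mult_right_mono) auto
    from order_trans[OF this me(1)] have "real j * e k \<in> {0..t}" using e(1)[of k] by simp
    then have "norm (mat_exp ((real j * e k) *\<^sub>R X)) \<le> \<bar>b\<bar>" using b by fastforce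
    then show ?thesis
      unfolding E_def mat_exp_of_nat[symmetric] B_def using K by (meson mult_left_mono less_imp_le order_trans)
  qed
  have "Bseq Z" using X unfolding Z_def[abs_def] by (rule convergent_imp_Bseq[OF convergentI])
  then obtain c where c: "c > 0" "\<And>k. norm (Z k) \<le> c" by (auto simp: Bseq_def)
  define C where "C = K * c"
  have C: "C > 0" using K c by (simp add: C_def)
  have a: "opnorm (g k) \<le> 1 + C * e k" for k
  proof -
    have "g k = mat 1 + e k *\<^sub>R Z k" using e(1)[of k] by (simp add: Z_def)
    then have "opnorm (g k) \<le> opnorm (mat 1 :: complex ^ 'i ^ 'i) + opnorm (e k *\<^sub>R Z k)"
      by (simp only: opnorm_add)
    also have "opnorm (e k *\<^sub>R Z k) \<le> K * (e k * c)"
      using K(2)[of "e k *\<^sub>R Z k"] c(2)[of k] e(1)[of k] K(1)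
      by (smt (verit) mult_left_mono norm_scaleR abs_of_pos mult_le_cancel_left_pos)
    finally show ?thesis using opnorm_one_le by (auto simp: C_def algebra_simps intro: order_trans add_mono)
  qed
  define \<delta> where "\<delta> k = K * norm (Z k - (1 / e k) *\<^sub>R (E k - mat 1))" for k
  have \<delta>: "\<delta> \<longlonglongrightarrow> 0"
  proof -
    have "(\<lambda>k. (1 / e k) *\<^sub>R (E k - mat 1)) \<longlonglongrightarrow> X"
      unfolding E_def using e by (intro mat_exp_difference_quotient) (auto simp: less_imp_neq[symmetric])
    from tendsto_mult[OF tendsto_const[of K] tendsto_norm[OF tendsto_diff[OF X this]]]
    show ?thesis by (simp add: \<delta>_def[abs_def] Z_def)
  qed
  have ab: "opnorm (g k - E k) \<le> e k * \<delta> k" for k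
  proof -
    have "g k - E k = e k *\<^sub>R (Z k - (1 / e k) *\<^sub>R (E k - mat 1))"
      using e(1)[of k] by (simp add: Z_def scaleR_diff_right)
    then show ?thesis using K(2)[of "g k - E k"] e(1)[of k] by (simp add: \<delta>_def mult_ac)
  qed
  have bound: "opnorm (mat_pow (g k) (m k) - mat_pow (E k) (m k)) \<le> t * B * exp (C * t) * \<delta> k" for k
  proof -
    have \<delta>0: "0 \<le> \<delta> k" using K by (simp add: \<delta>_def)
    have B0: "0 \<le> B" using K by (simp add: B_def)
    have "opnorm (mat_pow (g k) (m k) - mat_pow (E k) (m k))
        \<le> real (m k) * (e k * \<delta> k) * B * (1 + C * e k) ^ m k"
      using e(1)[of k] C B0 by (intro opnorm_mat_pow_diff a ab B) auto
    \<comment> \<open>As 1 + x \<le> exp x and the total time is at most \<open>t\<close>, the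
      growth factor becomes independent of \<open>k\<close>.\<close>
    also have "(1 + C * e k) ^ m k \<le> exp (C * e k) ^ m k"
      using e(1)[of k] C by (intro power_mono exp_ge_add_one_self) (auto intro: add_nonneg_nonneg)
    also have "\<dots> = exp (C * (real (m k) * e k))"
      by (simp add: exp_of_nat_mult[symmetric] mult_ac)
    also have "\<dots> \<le> exp (C * t)" using me(1)[of k] C by simp
    also have "real (m k) * (e k * \<delta> k) * B * exp (C * t) = (real (m k) * e k) * (\<delta> k * B * exp (C * t))"
      by (simp only: mult_ac)
    finally have "opnorm (mat_pow (g k) (m k) - mat_pow (E k) (m k))
        \<le> (real (m k) * e k) * (\<delta> k * B * exp (C * t))"
      using e(1)[of k] \<delta>0 B0 by (simp add: mult_left_mono)
    also have "\<dots> \<le> t * (\<delta> k * B * exp (C * t))"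
      using me(1)[of k] \<delta>0 B0 by (intro mult_right_mono) auto
    finally show ?thesis by (simp add: mult_ac)
  qed
  have "(\<lambda>k. mat_pow (g k) (m k) - mat_pow (E k) (m k)) \<longlonglongrightarrow> 0"
  proof (rule Lim_null_comparison)
    show "\<forall>\<^sub>F k in sequentially. norm (mat_pow (g k) (m k) - mat_pow (E k) (m k))
        \<le> real (CARD('i) * CARD('i)) * (t * B * exp (C * t) * \<delta> k)"
      by (intro always_eventually allI order_trans[OF norm_le_opnorm] mult_left_mono bound) auto
    show "(\<lambda>k. real (CARD('i) * CARD('i)) * (t * B * exp (C * t) * \<delta> k)) \<longlonglongrightarrow> 0"
      using tendsto_mult_right_zero[OF tendsto_mult_right_zero[OF \<delta>]] by simp
  qed
  moreover have "(\<lambda>k. mat_pow (E k) (m k)) \<longlonglongrightarrow> mat_exp (t *\<^sub>R X)"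
  proof -
    have "(\<lambda>k. real (m k) * e k) \<longlonglongrightarrow> t"
    proof (rule tendsto_sandwich[of "\<lambda>k. t - e k" _ _ "\<lambda>k. t"])
      show "(\<lambda>k. t - e k) \<longlonglongrightarrow> t" using tendsto_diff[OF tendsto_const e(2)] by simp
    qed (use me in auto)
    moreover have "isCont (\<lambda>s. mat_exp (s *\<^sub>R X)) t"
      by (rule has_vector_derivative_continuous[OF mat_exp_has_vector_derivative])
    ultimately have "(\<lambda>k. mat_exp ((real (m k) * e k) *\<^sub>R X)) \<longlonglongrightarrow> mat_exp (t *\<^sub>R X)"
      by (rule isCont_tendsto_compose[rotated])
    then show ?thesis by (simp only: mat_exp_of_nat E_def)
  qed
  ultimately have "(\<lambda>k. (mat_pow (g k) (m k) - mat_pow (E k) (m k)) + mat_pow (E k) (m k)) \<longlonglongrightarrow> 0 + mat_exp (t *\<^sub>R X)"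
    by (rule tendsto_add)
  then show ?thesis by (simp add: m_def)
qed

text \<open>\<open>\<nu>\<close> stands for the projection to A, written multiplicatively. Limits
  come with a left inverse so that \<open>\<nu>\<close> stays positive at them when the hypothesis
  is verified by \<open>MA_closed\<close>.\<close>

lemma closed_group_one_parameter_subgroup:
  fixes F :: "(complex ^ 'i::finite ^ 'i) set" and \<nu> :: "complex ^ 'i ^ 'i \<Rightarrow> real"
  assumes one: "mat 1 \<in> F" and mult: "\<And>f g. f \<in> F \<Longrightarrow> g \<in> F \<Longrightarrow> f ** g \<in> F"
    and inv: "\<And>f. f \<in> F \<Longrightarrow> \<exists>h\<in>F. h ** f = mat 1"
    and closed: "\<And>s l h. (\<And>k::nat. s k \<in> F) \<Longrightarrow> s \<longlonglongrightarrow> l \<Longrightarrow> h ** l = mat 1 \<Longrightarrow> l \<in> F"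
    and conn: "connected F" and cont: "continuous_on F \<nu>"
    and \<nu>_mult: "\<And>f g. f \<in> F \<Longrightarrow> g \<in> F \<Longrightarrow> \<nu> (f ** g) = \<nu> f * \<nu> g" and \<nu>_one: "\<nu> (mat 1) = 1"
    and nontrivial: "f0 \<in> F" "\<nu> f0 \<noteq> 1"
  obtains X where "\<And>t. mat_exp (t *\<^sub>R X) \<in> F" and "\<exists>t. \<nu> (mat_exp (t *\<^sub>R X)) \<noteq> 1"
proof -
  \<comment> \<open>If \<open>\<nu>\<close> were 1 near the identity, translation would make it
    locally constant, and connectedness would make it 1 on all of \<open>F\<close>.\<close>
  have near: "\<exists>f\<in>F. norm (f - mat 1) < \<epsilon> \<and> \<nu> f \<noteq> 1" if "\<epsilon> > 0" for \<epsilon>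
  proof (rule ccontr)
    assume neg: "\<not> ?thesis"
    have "\<forall>\<^sub>F b in at a within F. \<nu> a = \<nu> b" if a: "a \<in> F" for a
    proof -
      obtain h where h: "h \<in> F" "h ** a = mat 1" using inv[OF a] by blast
      have "((\<lambda>b. h ** b) \<longlongrightarrow> h ** a) (at a within F)"
        by (intro mm.tendsto tendsto_const tendsto_ident_at)
      then have "\<forall>\<^sub>F b in at a within F. dist (h ** b) (mat 1) < \<epsilon>"
        using \<open>\<epsilon> > 0\<close> unfolding h(2) by (rule tendstoD)
      moreover have "\<forall>\<^sub>F b in at a within F. b \<in> F" by (simp add: eventually_at_filter)
      ultimately show ?thesis
      proof eventually_elim
        case (elim b)
        then have "\<nu> (h ** b) = 1" using neg mult[OF h(1)] by (auto simp: dist_norm)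
        then have "\<nu> h * \<nu> b = \<nu> h * \<nu> a" "\<nu> h * \<nu> b = 1"
          using \<nu>_mult[OF h(1) a] \<nu>_mult[OF h(1) elim(2)] h(2) \<nu>_one by simp_all
        then show ?case by (metis mult_cancel_left mult_zero_left zero_neq_one)
      qed
    qed
    then have "\<nu> f0 = \<nu> (mat 1)"
      using connected_local_const[OF conn nontrivial(1) one] by blast
    then show False using nontrivial \<nu>_one by simp
  qed
  \<comment> \<open>The last clause makes \<open>g\<close> nearly minimise the distance to \<open>1\<close> in its coset modulo the kernel of
    \<open>\<nu>\<close>. If all of \<open>exp (t X)\<close> were in the kernel, the factor \<open>h = exp (- e\<^sub>k X)\<close> would violate it.\<close>
  define good where "good \<epsilon> g \<longleftrightarrow> g \<in> F \<and> 0 < norm (g - mat 1) \<and> norm (g - mat 1) < \<epsilon> \<and>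
      (\<forall>h\<in>F. \<nu> h = 1 \<longrightarrow> norm (g - mat 1) \<le> 2 * norm (g ** h - mat 1))" for \<epsilon> g
  have "\<exists>g. good \<epsilon> g" if \<epsilon>: "\<epsilon> > 0" for \<epsilon>
  proof -
    obtain f where f: "f \<in> F" "norm (f - mat 1) < \<epsilon>" "\<nu> f \<noteq> 1" using near[OF \<epsilon>] by blast
    \<comment> \<open>The distances to 1 within the coset of \<open>f\<close>. There
      \<open>\<nu>\<close> keeps the value \<open>\<nu> f\<close>, different from 1, so continuity
      at 1 gives a positive lower bound \<open>d\<close>.\<close>
    define D where "D = {norm (f ** h - mat 1) | h. h \<in> F \<and> \<nu> h = 1}"
    obtain d where d: "d > 0" "\<And>f'. f' \<in> F \<Longrightarrow> dist f' (mat 1) < d \<Longrightarrow> dist (\<nu> f') (\<nu> (mat 1)) < dist (\<nu> f) 1"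
      using cont one f(3) unfolding continuous_on_iff by (metis zero_less_dist_iff)
    have lower: "d \<le> x" if xD: "x \<in> D" for x
    proof -
      obtain h where h: "x = norm (f ** h - mat 1)" "h \<in> F" "\<nu> h = 1" using xD by (auto simp: D_def)
      have "\<nu> (f ** h) = \<nu> f" using \<nu>_mult f h by simp
      then show ?thesis using d(2)[OF mult[OF f(1) h(2)]] \<nu>_one h(1) by (force simp: dist_norm)
    qed
    have fD: "norm (f - mat 1) \<in> D" using one \<nu>_one by (force simp: D_def)
    then have "D \<noteq> {}" by blast
    have bdd: "bdd_below D" using lower by (rule bdd_belowI)
    have "d \<le> Inf D" using lower \<open>D \<noteq> {}\<close> by (intro cInf_greatest) auto
    moreover have "Inf D < \<epsilon>" using cInf_lower[OF fD bdd] f(2) by simp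
    \<comment> \<open>A positive infimum is strictly less than its double, so a near minimiser
      exists whether or not the minimum is attained.\<close>
    ultimately have "Inf D < min (2 * Inf D) \<epsilon>" using d(1) by auto
    then obtain x where x: "x \<in> D" "x < min (2 * Inf D) \<epsilon>"
      using cInf_lessD[OF \<open>D \<noteq> {}\<close>] by blast
    then obtain h0 where h0: "x = norm (f ** h0 - mat 1)" "h0 \<in> F" "\<nu> h0 = 1" by (auto simp: D_def)
    have "norm (f ** h0 - mat 1) \<le> 2 * norm (f ** h0 ** h - mat 1)" if h: "h \<in> F" "\<nu> h = 1" for h
    proof -
      have "norm (f ** h0 ** h - mat 1) \<in> D"
        using mult[OF h0(2) h(1)] \<nu>_mult[OF h0(2) h(1)] h0 h
        by (auto simp: D_def matrix_mul_assoc[symmetric] intro!: exI[of _ "h0 ** h"])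
      from cInf_lower[OF this bdd] show ?thesis using x h0(1) by simp
    qed
    moreover have "0 < norm (f ** h0 - mat 1)" "norm (f ** h0 - mat 1) < \<epsilon>"
      using x(2) h0(1) lower[OF x(1)] d(1) by linarith+
    ultimately have "good \<epsilon> (f ** h0)"
      using mult[OF f(1) h0(2)] unfolding good_def by blast
    then show ?thesis by blast
  qed
  then have "\<exists>g. good (inverse (real (Suc k))) g" for k by simp
  then obtain g where g: "\<And>k. good (inverse (real (Suc k))) (g k)" by metis
  define e where "e k = norm (g k - mat 1)" for k
  define Z where "Z k = (1 / e k) *\<^sub>R (g k - mat 1)" for k
  have e0: "e k > 0" "e k < inverse (real (Suc k))" for k using g[of k] by (simp_all add: good_def e_def)
  have e_lim: "e \<longlonglongrightarrow> 0"
    by (rule tendsto_sandwich[OF _ _ tendsto_const LIMSEQ_inverse_real_of_nat])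
       (use e0 in \<open>auto intro!: always_eventually less_imp_le\<close>)
  have "Z k \<in> sphere 0 1" for k using e0(1)[of k] by (simp add: Z_def e_def)
  then obtain X r where r: "strict_mono r" "(Z \<circ> r) \<longlonglongrightarrow> X"
    using compact_sphere unfolding compact_def by metis
  have e': "\<And>k. (e \<circ> r) k > 0" "(e \<circ> r) \<longlonglongrightarrow> 0"
    using e0 LIMSEQ_subseq_LIMSEQ[OF e_lim r(1)] by auto
  have Z': "(\<lambda>k. (1 / (e \<circ> r) k) *\<^sub>R (g (r k) - mat 1)) \<longlonglongrightarrow> X"
    using r(2) by (simp add: Z_def o_def)
  have gF: "g k \<in> F" for k using g[of k] by (simp add: good_def)
  have powF: "mat_pow f m \<in> F" if "f \<in> F" for f m
    by (induction m) (auto simp: mat_pow_Suc one mult that)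
  have pos: "mat_exp (t *\<^sub>R X) \<in> F" if "t \<ge> 0" for t
    by (rule closed[OF powF[OF gF] mat_pow_tendsto_mat_exp[OF e' Z' that] mat_exp_minus_mult])
  have X: "mat_exp (t *\<^sub>R X) \<in> F" for t
  proof (cases "t \<ge> 0")
    case False
    \<comment> \<open>Negative times: the inverse supplied by the group must be the
      exponential.\<close>
    then obtain h where h: "h \<in> F" "h ** mat_exp ((- t) *\<^sub>R X) = mat 1" using inv[OF pos[of "- t"]] by auto
    have "h = h ** (mat_exp ((- t) *\<^sub>R X) ** mat_exp (t *\<^sub>R X))" by (simp only: mat_exp_minus_mult matrix_mul_rid)
    also have "\<dots> = mat_exp (t *\<^sub>R X)" by (simp only: matrix_mul_assoc h(2) matrix_mul_lid)
    finally show ?thesis using h(1) by simp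
  qed (rule pos)
  moreover have "\<exists>t. \<nu> (mat_exp (t *\<^sub>R X)) \<noteq> 1"
  proof (rule ccontr)
    assume "\<not> ?thesis"
    then have trivial: "\<nu> (mat_exp (t *\<^sub>R X)) = 1" for t by blast
    define h where "h k = mat_exp ((- (e \<circ> r) k) *\<^sub>R X)" for k
    have "(\<lambda>k. (1 / (- (e \<circ> r) k)) *\<^sub>R (h k - mat 1)) \<longlonglongrightarrow> X"
      unfolding h_def using e'(2) tendsto_minus[OF e'(2)]
      by (intro mat_exp_difference_quotient) (auto simp: e0(1)[THEN less_imp_neq, symmetric])
    moreover have "(\<lambda>k. g (r k)) \<longlonglongrightarrow> mat 1"
    proof -
      have "(\<lambda>k. (e \<circ> r) k *\<^sub>R ((1 / (e \<circ> r) k) *\<^sub>R (g (r k) - mat 1)) + mat 1) \<longlonglongrightarrow> 0 *\<^sub>R X + mat 1"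
        by (intro tendsto_intros e'(2) Z')
      then show ?thesis using e'(1) by (simp add: e0(1)[THEN less_imp_neq, symmetric])
    qed
    \<comment> \<open>To first order \<open>g (r k)\<close> moves by e X and \<open>h k\<close> by
      -e X, so the product differs from 1 by o(e), against near minimality.\<close>
    ultimately have "(\<lambda>k. (1 / (e \<circ> r) k) *\<^sub>R (g (r k) - mat 1)
        - g (r k) ** ((1 / (- (e \<circ> r) k)) *\<^sub>R (h k - mat 1))) \<longlonglongrightarrow> X - mat 1 ** X"
      by (intro tendsto_diff mm.tendsto Z')
    moreover have "(1 / (e \<circ> r) k) *\<^sub>R (g (r k) - mat 1) - g (r k) ** ((1 / (- (e \<circ> r) k)) *\<^sub>R (h k - mat 1))
        = (1 / e (r k)) *\<^sub>R (g (r k) ** h k - mat 1)" for k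
      by (simp add: mm.scaleR_right mm.diff_right scaleR_diff_right)
    ultimately have "(\<lambda>k. (1 / e (r k)) *\<^sub>R (g (r k) ** h k - mat 1)) \<longlonglongrightarrow> 0" by simp
    then have "(\<lambda>k. norm ((1 / e (r k)) *\<^sub>R (g (r k) ** h k - mat 1))) \<longlonglongrightarrow> 0"
      by (rule tendsto_norm_zero)
    moreover have "1 / 2 \<le> norm ((1 / e (r k)) *\<^sub>R (g (r k) ** h k - mat 1))" for k
    proof -
      have "e (r k) \<le> 2 * norm (g (r k) ** h k - mat 1)"
        using g[of "r k"] X trivial unfolding good_def e_def h_def by blast
      then show ?thesis using e0(1)[of "r k"] by (simp add: le_divide_eq)
    qed
    ultimately have "(1 / 2 :: real) \<le> 0" by (intro tendsto_lowerbound) auto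
    then show False by simp
  qed
  ultimately show ?thesis by (rule that)
qed

section \<open>Iwasawa decompositions\<close>

lemma cdot_eq_0: "(\<And>w. cdot v w = 0) \<Longrightarrow> v = 0"
  using cdot_self[of v] by simp

lemma su_n1_iff: "X \<in> su_n1 \<longleftrightarrow> skew X \<and> trace X = 0"
proof
  assume X: "skew X \<and> trace X = 0"
  then have "(conj_transpose X ** form_matrix + form_matrix ** X) *v v = 0" for v
    by (intro cdot_eq_0) (simp add: skew_def herm_skew_defect)
  then have "conj_transpose X ** form_matrix + form_matrix ** X = 0"
    by (simp add: matrix_eq)
  then show "X \<in> su_n1" using X by (simp add: su_n1_def)
qed (simp add: su_n1_def skew_def herm_skew_defect cdot.zero_left)

text \<open>The form is nondegenerate: a vector of the kernel pairs to zero with everything, and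
  \<open>lift 0\<close> and \<open>lift (space_part v)\<close> suffice as tests.\<close>

lemma isometric_invertible:
  assumes "isometric g"
  shows "invertible g" and "g ** matrix_inv g = mat 1" and "matrix_inv g ** g = mat 1"
    and "isometric (matrix_inv g)"
proof -
  have "v = 0" if "g *v v = 0" for v
  proof -
    have "herm v w = 0" for w
      using assms that herm.zero_left unfolding isometric_def by metis
    then have "v $ None * cnj (w $ None) = cdot (space_part v) (space_part w)" for w
      by (simp add: herm_def)
    from this[of "lift 0"] this[of "lift (space_part v)"] show "v = 0"
      by (auto simp: cdot.zero_right cdot_self vec_option_eq_iff vec_eq_iff)
  qed
  then have "inj ((*v) g)"
    by (metis injI mv.diff_right right_minus_eq)
  then obtain h where "h ** g = mat 1"
    using matrix_left_invertible_injective by blast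
  then show inv: "invertible g"
    using matrix_left_right_inverse invertible_def by blast
  then have "g ** matrix_inv g = mat 1 \<and> matrix_inv g ** g = mat 1"
    unfolding invertible_def matrix_inv_def by (rule someI_ex)
  then show "g ** matrix_inv g = mat 1" "matrix_inv g ** g = mat 1" by auto
  then show "isometric (matrix_inv g)" using isometric_left_inverse[OF assms] by blast
qed

text \<open>The infinitesimal isometry sending y to <y,\<xi>> w - <y,w> \<xi>; the sign on the
  column \<open>None\<close> inserts the form. With \<open>\<xi>\<close> null and \<open>w\<close>
  orthogonal to it, or an imaginary multiple of it, these furnish the root vectors.\<close>

definition rank2 :: "complex ^ 'n::finite option \<Rightarrow> complex ^ 'n option \<Rightarrow> 'n cmat" where
  "rank2 w \<xi> = (\<chi> i j. (w $ i * cnj (\<xi> $ j) - \<xi> $ i * cnj (w $ j)) * (if j = None then - 1 else 1))"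

lemma rank2_vec: "rank2 w \<xi> *v y = herm y \<xi> *s w - herm y w *s \<xi>"
proof -
  have "(rank2 w \<xi> *v y) $ i = herm y \<xi> * w $ i - herm y w * \<xi> $ i" for i
    by (simp add: matrix_vector_mult_def rank2_def sum_option herm_def cdot_def algebra_simps
        sum_distrib_left sum_subtractf)
  then show ?thesis by (simp add: vec_eq_iff)
qed

lemma rank2_scaleR: "t *\<^sub>R rank2 w \<xi> = rank2 (t *\<^sub>R w) \<xi>"
  by (simp add: vec_eq_iff rank2_def scaleR_conv_of_real[where 'a=complex] algebra_simps)

lemma rank2_add: "rank2 (v + w) \<xi> = rank2 v \<xi> + rank2 w \<xi>"
  by (simp add: vec_eq_iff rank2_def algebra_simps)

lemma skew_rank2: "skew (rank2 w \<xi>)"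
  unfolding skew_def
  by (simp add: rank2_vec herm.diff_left herm.diff_right herm_smult_left herm_smult_right cnj_herm algebra_simps)

lemma trace_rank2: "trace (rank2 w \<xi>) = herm w \<xi> - herm \<xi> w"
  by (simp add: trace_def rank2_def sum_option herm_def cdot_def sum_subtractf algebra_simps)

locale rank_one =
  fixes T :: "'n::finite cmat"
  assumes T_cartan: "T \<in> cartan_p" and T_nonzero: "T \<noteq> 0"
begin

text \<open>\<open>T\<close> vanishes on the diagonal blocks, so this column determines it. Its
  eigenvalues lie among \<tau>, 0 and -\<tau>, and \<open>u\<close> is the ideal point at which
  exp(tT) 0 arrives.\<close>

definition x where "x = space_part (column None T)"
definition \<tau> where "\<tau> = norm x"
definition u where "u = (1 / \<tau>) *\<^sub>R x"
abbreviation "\<xi> \<equiv> lift u"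

lemma skew_T: "skew T"
  using T_cartan by (simp add: cartan_p_def su_n1_iff)

lemma T_entries: "T $ None $ None = 0" "T $ Some i $ Some j = 0" "T $ Some i $ None = x $ i" "T $ None $ Some i = cnj (x $ i)"
proof -
  have herm: "cnj (T $ j $ i) = T $ i $ j" for i j
    using T_cartan by (simp add: cartan_p_def conj_transpose_def vec_eq_iff)
  have "conj_transpose T ** form_matrix + form_matrix ** T = 0" and ct: "conj_transpose T = T"
    using T_cartan unfolding cartan_p_def su_n1_def by blast+
  then have "(T ** form_matrix + form_matrix ** T) $ i $ j = 0" for i j by (simp only: ct zero_index)
  moreover have "(T ** form_matrix + form_matrix ** T) $ i $ j
      = T $ i $ j * (if j = None then - 1 else 1) + (if i = None then - 1 else 1) * T $ i $ j" for i j
  proof -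
    have "(\<Sum>k\<in>UNIV. T $ i $ k * form_matrix $ k $ j) = (\<Sum>k\<in>UNIV. if k = j then T $ i $ k * (if j = None then - 1 else 1) else 0)"
      by (rule sum.cong) (auto simp: form_matrix_def)
    moreover have "(\<Sum>k\<in>UNIV. form_matrix $ i $ k * T $ k $ j) = (\<Sum>k\<in>UNIV. if i = k then (if i = None then - 1 else 1) * T $ k $ j else 0)"
      by (rule sum.cong) (auto simp: form_matrix_def)
    ultimately show ?thesis by (simp add: matrix_matrix_mult_def)
  qed
  ultimately have *: "T $ i $ j * (if j = None then - 1 else 1) + (if i = None then - 1 else 1) * T $ i $ j = 0" for i j
    by metis
  show "T $ None $ None = 0" "T $ Some i $ Some j = 0" using *[of None None] *[of "Some i" "Some j"] by simp_all
  show "T $ Some i $ None = x $ i" by (simp add: x_def column_def)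
  then show "T $ None $ Some i = cnj (x $ i)" using herm[of "Some i" None] by simp
qed

lemma T_vec: "(T *v y) $ None = cdot (space_part y) x" "(T *v y) $ Some i = x $ i * y $ None"
  by (simp_all add: matrix_vector_mult_def sum_option T_entries cdot_def mult.commute)

lemma \<tau>_pos: "\<tau> > 0"
proof (rule ccontr)
  assume "\<not> \<tau> > 0"
  then have "x = 0" by (simp add: \<tau>_def)
  then have "T = 0" by (simp add: vec_eq_iff split_option_all T_entries)
  then show False using T_nonzero by simp
qed

lemma x_u: "x = \<tau> *\<^sub>R u" and norm_u: "norm u = 1" and cdot_u_u: "cdot u u = 1" and cdot_x: "cdot v x = of_real \<tau> * cdot v u"
proof -
  show x: "x = \<tau> *\<^sub>R u" using \<tau>_pos by (simp add: u_def)
  show "norm u = 1" using \<tau>_pos by (simp add: u_def) (simp add: \<tau>_def)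
  then show "cdot u u = 1" by (simp add: cdot_self)
  show "cdot v x = of_real \<tau> * cdot v u" unfolding x by (simp add: cdot.scaleR_right scaleR_conv_of_real[where 'a=complex])
qed

lemma x_nth: "x $ i = of_real \<tau> * u $ i"
  unfolding x_u by (simp add: scaleR_conv_of_real[where 'a=complex])

lemma herm_\<xi>_\<xi>: "herm \<xi> \<xi> = 0"
  by (simp add: herm_lift cdot_u_u)

lemma T_\<xi>: "T *v \<xi> = of_real \<tau> *s \<xi>"
  by (simp add: vec_option_eq_iff T_vec cdot_x cdot_u_u x_nth)

text \<open>Simplicity of the top eigenvalue; whatever commutes with \<open>T\<close> therefore
  preserves the line of \<open>\<xi>\<close>.\<close>

lemma T_eigenvector:
  assumes "T *v y = of_real \<tau> *s y"
  shows "y = y $ None *s \<xi>"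
proof -
  have "x $ i * y $ None = of_real \<tau> * y $ Some i" for i
    using assms T_vec(2)[of y i] by simp
  then show ?thesis using \<tau>_pos by (simp add: vec_option_eq_iff x_nth mult.commute)
qed

lemma T_large_eigenvalue:
  assumes "T *v y = of_real \<kappa> *s y" and "\<kappa> > \<tau>"
  shows "y = 0"
proof -
  have i: "of_real \<tau> * u $ i * y $ None = of_real \<kappa> * y $ Some i" for i
    using assms(1) T_vec(2)[of y i] by (simp add: x_nth)
  have s: "of_real \<tau> * cdot (space_part y) u = of_real \<kappa> * y $ None"
    using assms(1) T_vec(1)[of y] by (simp add: cdot_x)
  have k: "\<kappa> > 0" using assms(2) \<tau>_pos by simp
  \<comment> \<open>Pairing the spatial equation with \<open>u\<close> leaves two scalar equations,
    solvable with nonzero last coordinate only if \<kappa> and \<tau> have equal squares.\<close>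
  have "of_real \<kappa> *s space_part y = (of_real \<tau> * y $ None) *s u"
    using i by (simp add: vec_eq_iff mult_ac)
  then have "of_real \<kappa> * cdot (space_part y) u = of_real \<tau> * y $ None"
    by (metis cdot_smult_left cdot_u_u mult.right_neutral)
  with s have "of_real (\<tau>\<^sup>2) * y $ None = of_real (\<kappa>\<^sup>2) * y $ None"
    by (metis (no_types, lifting) mult.assoc mult.left_commute of_real_mult power2_eq_square)
  moreover have "\<tau>\<^sup>2 \<noteq> \<kappa>\<^sup>2"
    using assms(2) \<tau>_pos by (simp add: power2_eq_iff)
  ultimately have "y $ None = 0" by (simp del: of_real_power)
  then show ?thesis using i k by (simp add: vec_option_eq_iff)
qed

section \<open>The action of N, A and M on the null vector\<close>

definition \<nn> where "\<nn> = span (\<Union>c\<in>{0<..}. root_space T c)"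

lemma iwasawa_N_\<nn>: "iwasawa_N T = mat_exp ` \<nn>"
  by (simp add: iwasawa_N_def \<nn>_def)

lemma \<nn>_scaleR: "X \<in> \<nn> \<Longrightarrow> t *\<^sub>R X \<in> \<nn>" and \<nn>_zero: "0 \<in> \<nn>"
  unfolding \<nn>_def by (simp_all add: span_scale span_zero)

text \<open>A root vector for c > 0 would send \<open>\<xi>\<close> to an eigenvector with
  eigenvalue \<tau> + c, above the spectrum. Both properties are linear and so pass to the
  span.\<close>

lemma \<nn>_skew_null: assumes "X \<in> \<nn>" shows "skew X" and "X *v \<xi> = 0"
proof -
  have "subspace {X. skew X \<and> X *v \<xi> = 0}"
  proof (rule subspaceI)
    show "0 \<in> {X :: 'n cmat. skew X \<and> X *v \<xi> = 0}"
      by (simp add: skew_def herm.zero_left herm.zero_right)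
  next
    fix X Y :: "'n cmat"
    assume XY: "X \<in> {X. skew X \<and> X *v \<xi> = 0}" "Y \<in> {X. skew X \<and> X *v \<xi> = 0}"
    have "herm (X *v v) w + herm v (X *v w) + (herm (Y *v v) w + herm v (Y *v w)) = 0" for v w
      using XY by (simp add: skew_def)
    then show "X + Y \<in> {X. skew X \<and> X *v \<xi> = 0}"
      using XY by (simp add: skew_def mv.add_left herm.add_left herm.add_right add_ac)
  next
    fix c and X :: "'n cmat"
    assume X: "X \<in> {X. skew X \<and> X *v \<xi> = 0}"
    have "c *\<^sub>R (herm (X *v v) w + herm v (X *v w)) = 0" for v w
      using X by (simp add: skew_def)
    then show "c *\<^sub>R X \<in> {X. skew X \<and> X *v \<xi> = 0}"
      using X by (simp add: skew_def mv.scaleR_left herm.scaleR_left herm.scaleR_right scaleR_add_right)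
  qed
  moreover have "root_space T c \<subseteq> {X. skew X \<and> X *v \<xi> = 0}" if c: "c > 0" for c
  proof
    fix X assume X: "X \<in> root_space T c"
    then have "T ** X = c *\<^sub>R X + X ** T" by (simp add: root_space_def diff_eq_eq)
    then have "T *v (X *v \<xi>) = c *\<^sub>R (X *v \<xi>) + X *v (T *v \<xi>)"
      by (simp add: matrix_vector_mul_assoc mv.add_left mv.scaleR_left)
    also have "\<dots> = of_real (c + \<tau>) *s (X *v \<xi>)"
      by (simp add: T_\<xi> matrix_vector_mult_smult vec_eq_iff scaleR_conv_of_real[where 'a=complex] algebra_simps)
    finally have "X *v \<xi> = 0" by (rule T_large_eigenvalue) (use c in simp)
    then show "X \<in> {X. skew X \<and> X *v \<xi> = 0}" using X by (simp add: root_space_def su_n1_iff)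
  qed
  ultimately have "\<nn> \<subseteq> {X. skew X \<and> X *v \<xi> = 0}"
    unfolding \<nn>_def by (intro span_minimal) auto
  then show "skew X" "X *v \<xi> = 0" using assms by auto
qed

lemma iwasawa_N_fixes: assumes "n \<in> iwasawa_N T" shows "isometric n" and "n *v \<xi> = \<xi>"
proof -
  obtain X where X: "X \<in> \<nn>" "n = mat_exp X" using assms by (auto simp: iwasawa_N_\<nn>)
  show "isometric n" using isometric_mat_exp[OF \<nn>_skew_null(1)[OF X(1)], of 1] X(2) by simp
  have "X *v \<xi> = 0 *s \<xi>" using \<nn>_skew_null(2)[OF X(1)] by simp
  from mat_exp_eigenvector[OF this] show "n *v \<xi> = \<xi>" using X(2) by simp
qed

lemma exp_T_\<xi>: "mat_exp (t *\<^sub>R T) *v \<xi> = of_real (exp (t * \<tau>)) *s \<xi>"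
proof -
  have "(t *\<^sub>R T) *v \<xi> = of_real (t * \<tau>) *s \<xi>"
    by (simp add: mv.scaleR_left T_\<xi> vec_eq_iff scaleR_conv_of_real[where 'a=complex])
  from mat_exp_eigenvector[OF this] show ?thesis by (simp only: exp_of_real)
qed

text \<open>Commuting with A differentiates to commuting with \<open>T\<close>, so
  \<open>T_eigenvector\<close> applies. Block form identifies the eigenvalue with the corner entry,
  and the form at \<open>lift 0\<close> gives it modulus 1.\<close>

lemma centralizer_M_eigen:
  assumes "m \<in> centralizer_M T"
  shows "isometric m" and "m *v \<xi> = m $ None $ None *s \<xi>" and "norm (m $ None $ None) = 1"
    and "m ** mat_exp (t *\<^sub>R T) = mat_exp (t *\<^sub>R T) ** m" and "m $ Some i $ None = 0"
proof -
  have m: "m \<in> SUn1" "\<And>i. m $ Some i $ None = 0" "\<And>i. m $ None $ Some i = 0"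
    using assms by (auto simp: centralizer_M_def maxK_def)
  show iso: "isometric m" using m(1) by (rule isometric_SUn1)
  show comm: "m ** mat_exp (t *\<^sub>R T) = mat_exp (t *\<^sub>R T) ** m" for t
    using assms by (simp add: centralizer_M_def iwasawa_A_def)
  show "m $ Some i $ None = 0" by (rule m)
  have "((\<lambda>t. m ** mat_exp (t *\<^sub>R T)) has_vector_derivative m ** T) (at 0)"
    using bounded_linear.has_vector_derivative[OF mm.bounded_linear_right mat_exp_has_vector_derivative[of T 0]] by simp
  moreover have "((\<lambda>t. m ** mat_exp (t *\<^sub>R T)) has_vector_derivative T ** m) (at 0)"
    unfolding comm
    using bounded_linear.has_vector_derivative[OF mm.bounded_linear_left mat_exp_has_vector_derivative[of T 0]] by simp
  ultimately have "m ** T = T ** m" by (rule vector_derivative_unique_at)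
  then have "T *v (m *v \<xi>) = of_real \<tau> *s (m *v \<xi>)"
    by (metis T_\<xi> matrix_vector_mul_assoc matrix_vector_mult_smult)
  then have "m *v \<xi> = (m *v \<xi>) $ None *s \<xi>" by (rule T_eigenvector)
  moreover have "(m *v \<xi>) $ None = m $ None $ None"
    by (simp add: matrix_vector_mult_def sum_option m)
  ultimately show "m *v \<xi> = m $ None $ None *s \<xi>" by simp
  have "m *v lift 0 = m $ None $ None *s lift 0"
    by (simp add: vec_option_eq_iff matrix_vector_mult_def sum_option m)
  moreover have "herm (m *v lift 0) (m *v lift 0) = herm (lift (0 :: complex ^ 'n)) (lift 0)"
    using iso by (simp add: isometric_def)
  ultimately have "m $ None $ None * cnj (m $ None $ None) = 1"
    by (simp add: herm_smult_left herm_smult_right herm_lift cdot.zero_left mult.commute)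
  then show "norm (m $ None $ None) = 1"
    by (metis complex_norm_square norm_ge_zero of_real_eq_1_iff one_power2 power2_eq_imp_eq zero_le_one)
qed

text \<open>The modulus of the eigenvalue on \<open>\<xi>\<close>, written as a ratio of norms so
  that it is continuous on all matrices. On MA it is exp(t \<tau>), the A-part.\<close>

definition \<nu> where "\<nu> g = norm (g *v \<xi>) / norm \<xi>"

lemma norm_\<xi>: "norm \<xi> > 0"
  by (metis lift_nth(1) zero_index zero_less_norm_iff zero_neq_one)

lemma \<nu>_eigen: "g *v \<xi> = c *s \<xi> \<Longrightarrow> \<nu> g = norm c"
  using norm_\<xi> by (simp add: \<nu>_def norm_smult)

lemma continuous_\<nu>: "continuous_on S \<nu>"
  unfolding \<nu>_def[abs_def] using norm_\<xi>
  by (intro continuous_intros bounded_linear.continuous_on[OF mv.bounded_linear_left] continuous_on_id) auto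

lemma MA_eigen:
  assumes "m \<in> centralizer_M T"
  shows "isometric (m ** mat_exp (t *\<^sub>R T))"
    and "(m ** mat_exp (t *\<^sub>R T)) *v \<xi> = (m $ None $ None * of_real (exp (t * \<tau>))) *s \<xi>"
    and "\<nu> (m ** mat_exp (t *\<^sub>R T)) = exp (t * \<tau>)"
proof -
  show "isometric (m ** mat_exp (t *\<^sub>R T))"
    by (intro isometric_mult centralizer_M_eigen(1)[OF assms] isometric_mat_exp skew_T)
  show "(m ** mat_exp (t *\<^sub>R T)) *v \<xi> = (m $ None $ None * of_real (exp (t * \<tau>))) *s \<xi>"
    by (simp add: matrix_vector_mul_assoc[symmetric] exp_T_\<xi> matrix_vector_mult_smult centralizer_M_eigen(2)[OF assms]
        mult.commute)
  from \<nu>_eigen[OF this] show "\<nu> (m ** mat_exp (t *\<^sub>R T)) = exp (t * \<tau>)"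
    by (simp add: norm_mult centralizer_M_eigen(3)[OF assms] del: of_real_exp)
qed

section \<open>Limits in M and in MA\<close>

lemma centralizer_M_closed:
  assumes m: "\<And>k::nat. s k \<in> centralizer_M T" and lim: "s \<longlonglongrightarrow> l"
  shows "l \<in> centralizer_M T"
proof -
  have nth: "(\<lambda>k. s k $ i $ j) \<longlonglongrightarrow> l $ i $ j" for i j
    by (intro tendsto_vec_nth lim)
  have ct: "(\<lambda>k. conj_transpose (s k)) \<longlonglongrightarrow> conj_transpose l"
    by (intro vec_tendstoI) (simp add: conj_transpose_def tendsto_cnj nth)
  have "(\<lambda>k. conj_transpose (s k) ** form_matrix ** s k) \<longlonglongrightarrow> conj_transpose l ** form_matrix ** l"
    by (intro mm.tendsto ct tendsto_const lim)
  moreover have "conj_transpose (s k) ** form_matrix ** s k = form_matrix" for k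
    using m[of k] by (simp add: centralizer_M_def maxK_def SUn1_def)
  ultimately have 1: "conj_transpose l ** form_matrix ** l = form_matrix"
    by (simp add: LIMSEQ_const_iff)
  have "(\<lambda>k. det (s k)) \<longlonglongrightarrow> det l"
    unfolding det_def by (intro tendsto_intros nth)
  moreover have "det (s k) = 1" for k
    using m[of k] by (simp add: centralizer_M_def maxK_def SUn1_def)
  ultimately have 2: "det l = 1"
    by (simp add: LIMSEQ_const_iff)
  have 3: "l $ Some i $ None = 0" "l $ None $ Some i = 0" for i
    using nth[of "Some i" None] nth[of None "Some i"] m
    by (simp_all add: centralizer_M_def maxK_def LIMSEQ_const_iff)
  have 4: "l ** a = a ** l" if "a \<in> iwasawa_A T" for a
  proof -
    have "(\<lambda>k. s k ** a) \<longlonglongrightarrow> l ** a" "(\<lambda>k. a ** s k) \<longlonglongrightarrow> a ** l"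
      by (intro mm.tendsto lim tendsto_const)+
    moreover have "s k ** a = a ** s k" for k using m[of k] that by (simp add: centralizer_M_def)
    ultimately show ?thesis using LIMSEQ_unique by auto
  qed
  show ?thesis using 1 2 3 4 by (simp add: centralizer_M_def maxK_def SUn1_def)
qed

text \<open>\<open>\<nu>\<close> recovers the A-parts continuously, so they converge; dividing them
  out, the M-parts converge too. The left inverse keeps \<open>\<nu> l\<close> positive, where
  \<open>ln\<close> is continuous.\<close>

lemma MA_closed:
  assumes s: "\<And>k::nat. s k \<in> mat_set_mult (centralizer_M T) (iwasawa_A T)" and lim: "s \<longlonglongrightarrow> l"
    and inv: "h ** l = mat 1"
  shows "l \<in> mat_set_mult (centralizer_M T) (iwasawa_A T)"
proof -
  have "\<exists>m t. m \<in> centralizer_M T \<and> s k = m ** mat_exp (t *\<^sub>R T)" for k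
    using s[of k] by (auto simp: mat_set_mult_def iwasawa_A_def)
  then obtain m t where mt: "\<And>k. m k \<in> centralizer_M T" "\<And>k. s k = m k ** mat_exp (t k *\<^sub>R T)"
    by metis
  have "l *v \<xi> \<noteq> 0"
    using inv norm_\<xi> by (metis matrix_vector_mul_assoc matrix_vector_mul_lid mv.zero_right norm_zero order_less_irrefl)
  then have \<nu>l: "\<nu> l > 0" using norm_\<xi> by (simp add: \<nu>_def)
  have "(\<lambda>k. \<nu> (s k)) \<longlonglongrightarrow> \<nu> l"
    unfolding \<nu>_def using norm_\<xi> by (intro tendsto_intros mv.tendsto lim) auto
  then have "(\<lambda>k. ln (\<nu> (s k)) / \<tau>) \<longlonglongrightarrow> ln (\<nu> l) / \<tau>"
    using \<nu>l \<tau>_pos by (intro tendsto_intros) auto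
  then have tl: "t \<longlonglongrightarrow> ln (\<nu> l) / \<tau>"
    using \<tau>_pos by (simp add: mt(2) MA_eigen(3)[OF mt(1)])
  define a where "a = ln (\<nu> l) / \<tau>"
  have "isCont (\<lambda>t. mat_exp (t *\<^sub>R T)) (- a)"
    by (rule has_vector_derivative_continuous[OF mat_exp_has_vector_derivative])
  then have "(\<lambda>k. mat_exp ((- t k) *\<^sub>R T)) \<longlonglongrightarrow> mat_exp ((- a) *\<^sub>R T)"
    using tendsto_minus[OF tl] unfolding a_def by (rule isCont_tendsto_compose)
  then have "(\<lambda>k. s k ** mat_exp ((- t k) *\<^sub>R T)) \<longlonglongrightarrow> l ** mat_exp ((- a) *\<^sub>R T)"
    by (intro mm.tendsto lim)
  moreover have "s k ** mat_exp ((- t k) *\<^sub>R T) = m k" for k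
    by (simp only: mt(2) matrix_mul_assoc[symmetric] mat_exp_mult_minus matrix_mul_rid)
  ultimately have "m \<longlonglongrightarrow> l ** mat_exp ((- a) *\<^sub>R T)" by simp
  from centralizer_M_closed[OF mt(1) this] have "l ** mat_exp ((- a) *\<^sub>R T) \<in> centralizer_M T" .
  moreover have "l = (l ** mat_exp ((- a) *\<^sub>R T)) ** mat_exp (a *\<^sub>R T)"
    by (simp only: matrix_mul_assoc[symmetric] mat_exp_minus_mult matrix_mul_rid)
  ultimately show ?thesis unfolding mat_set_mult_def iwasawa_A_def by blast
qed

section \<open>Elements of N and their orbit through the origin\<close>

lemma rank2_root_space:
  assumes "T *v w = of_real \<kappa> *s w" and "herm w \<xi> = 0"
  shows "rank2 w \<xi> \<in> root_space T (\<kappa> + \<tau>)"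
proof -
  have sk: "herm (T *v y) v = - herm y (T *v v)" for y v
    using skew_T by (simp add: skew_def eq_neg_iff_add_eq_0)
  have "herm \<xi> w = 0" using assms(2) cnj_herm[of w \<xi>] by simp
  then have "rank2 w \<xi> \<in> su_n1" using assms(2) by (simp add: su_n1_iff skew_rank2 trace_rank2)
  \<comment> \<open>As \<open>T\<close> is skew, its commutator with \<open>rank2 w \<xi>\<close>
    acts on \<open>w\<close> and on \<open>\<xi>\<close> separately, and the eigenvalues
    add.\<close>
  moreover have "(T ** rank2 w \<xi> - rank2 w \<xi> ** T) *v y = ((\<kappa> + \<tau>) *\<^sub>R rank2 w \<xi>) *v y" for y
    by (simp add: mv.diff_left mv.diff_right mv.scaleR_left matrix_vector_mul_assoc[symmetric] rank2_vec matrix_vector_mult_smult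
        sk assms T_\<xi> herm_smult_right vec_eq_iff scaleR_conv_of_real[where 'a=complex] algebra_simps)
  ultimately show ?thesis by (simp add: root_space_def matrix_eq)
qed

text \<open>The Heisenberg algebra: \<open>w\<close> gives the root \<tau> and \<open>s\<close> the
  centre, root 2\<tau>. The coefficient is imaginary because real multiples of \<open>\<xi>\<close>
  contribute nothing to \<open>rank2\<close>.\<close>

lemma rank2_\<nn>:
  assumes "cdot w u = 0"
  shows "rank2 ((lift w - lift 0) + (\<i> * of_real s) *s \<xi>) \<xi> \<in> \<nn>"
proof -
  have "rank2 (lift w - lift 0) \<xi> \<in> root_space T (0 + \<tau>)"
    by (rule rank2_root_space)
       (simp_all add: vec_option_eq_iff T_vec herm_def space_part_diff cdot_x assms)
  then have "rank2 (lift w - lift 0) \<xi> \<in> \<nn>"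
    unfolding \<nn>_def using \<tau>_pos by (intro span_base) auto
  moreover have "rank2 (\<i> *s \<xi>) \<xi> \<in> root_space T (\<tau> + \<tau>)"
    by (rule rank2_root_space)
       (simp_all add: matrix_vector_mult_smult T_\<xi> herm_smult_left herm_\<xi>_\<xi> mult.commute)
  then have "s *\<^sub>R rank2 (\<i> *s \<xi>) \<xi> \<in> \<nn>"
    unfolding \<nn>_def using \<tau>_pos by (intro span_scale span_base) auto
  moreover have "(\<i> * of_real s) *s \<xi> = s *\<^sub>R (\<i> *s \<xi>)"
    by (simp add: vec_eq_iff scaleR_conv_of_real[where 'a=complex])
  ultimately show ?thesis unfolding \<nn>_def by (simp add: rank2_add rank2_scaleR span_add)
qed

end

context rank_one begin

text \<open>The matrix lowers \<open>lift 0\<close> to a combination of \<open>W\<close> and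
  \<open>\<xi>\<close>, \<open>W\<close> to a multiple of \<open>\<xi>\<close>, and
  \<open>\<xi>\<close> to 0. Of the two terms i s, one sits in \<open>W\<close> and one is the
  pairing of \<open>lift 0\<close> with \<open>W\<close>.\<close>

lemma exp_rank2_vec_origin:
  assumes w: "cdot w u = 0"
  shows "mat_exp (rank2 ((lift w - lift 0) + (\<i> * of_real s) *s \<xi>) \<xi>) *v lift 0
    = lift 0 - (lift w - lift 0) + (of_real ((norm w)\<^sup>2 / 2) - 2 * \<i> * of_real s) *s \<xi>"
proof -
  define w1 where "w1 = lift w - lift 0"
  define W where "W = w1 + (\<i> * of_real s) *s \<xi>"
  have w1: "herm w1 \<xi> = 0" "herm \<xi> w1 = 0" "herm w1 w1 = of_real ((norm w)\<^sup>2)" "herm (lift 0) w1 = 0"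
    using w cnj_cdot[of w u] by (simp_all add: w1_def herm_def space_part_diff cdot_self cdot.zero_left)
  have e0: "herm (lift 0) \<xi> = - 1" by (simp add: herm_lift cdot.zero_left)
  have W: "herm W \<xi> = 0" "herm \<xi> W = 0" "herm W W = of_real ((norm w)\<^sup>2)" "herm (lift 0) W = \<i> * of_real s"
    by (simp_all add: W_def herm.add_left herm.add_right herm_smult_left herm_smult_right w1 herm_\<xi>_\<xi> e0)
  let ?X = "rank2 W \<xi>"
  have X0: "?X *v lift 0 = - W - (\<i> * of_real s) *s \<xi>"
    by (simp add: rank2_vec e0 W vec_eq_iff)
  have X1: "?X *v \<xi> = 0" by (simp add: rank2_vec W herm_\<xi>_\<xi>)
  have X2: "?X *v W = - (of_real ((norm w)\<^sup>2) *s \<xi>)" by (simp add: rank2_vec W)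
  have XX: "?X *v (?X *v lift 0) = of_real ((norm w)\<^sup>2) *s \<xi>"
    unfolding X0 by (simp only: mv.diff_right mv.minus_right matrix_vector_mult_smult X1 X2) (simp add: vec_eq_iff)
  have "?X *v (?X *v (?X *v lift 0)) = 0"
    unfolding XX by (simp only: matrix_vector_mult_smult X1) (simp add: vec_eq_iff)
  then have "mat_exp ?X *v lift 0 = lift 0 + ?X *v lift 0 + (1 / 2) *\<^sub>R (?X *v (?X *v lift 0))"
    by (rule mat_exp_nilpotent3)
  also have "\<dots> = lift 0 + (- W - (\<i> * of_real s) *s \<xi>) + (1 / 2) *\<^sub>R (of_real ((norm w)\<^sup>2) *s \<xi>)"
    unfolding XX unfolding X0 ..
  also have "\<dots> = lift 0 - w1 + (of_real ((norm w)\<^sup>2 / 2) - 2 * \<i> * of_real s) *s \<xi>"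
    by (simp add: W_def vec_eq_iff scaleR_conv_of_real[where 'a=complex] algebra_simps)
  finally show ?thesis by (simp add: W_def w1_def)
qed

text \<open>\<open>N\<close> acts transitively on the horosphere through the origin centred at \<open>u\<close>.\<close>

lemma horosphere_transitive:
  assumes h: "1 - (norm q)\<^sup>2 = (norm (1 - cdot q u))\<^sup>2" and ne: "cdot q u \<noteq> 1"
  obtains n c where "n \<in> iwasawa_N T" and "c \<noteq> 0" and "n *v lift 0 = c *s lift q"
proof -
  \<comment> \<open>Found by solving \<open>lift 0\<close> - (w, 0) + \<kappa> \<xi> = c
    \<open>lift q\<close>: the last coordinate gives \<kappa> = c - 1, the others give
    \<open>w\<close>, and \<open>cdot w u = 0\<close> forces c = 1 / b.\<close>
  define b where "b = 1 - cdot q u"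
  define c where "c = 1 / b"
  define \<kappa> where "\<kappa> = c - 1"
  define w where "w = \<kappa> *s u - c *s q"
  have b: "b \<noteq> 0" using ne by (simp add: b_def)
  then have cb: "c * b = 1" "c \<noteq> 0" "cnj c * cnj b = 1"
    by (simp_all add: c_def)
  have qu: "cdot q u = 1 - b" "cdot u q = 1 - cnj b"
    using cnj_cdot[of q u] by (auto simp: b_def)
  have "(norm q)\<^sup>2 = 1 - (norm b)\<^sup>2" using h by (simp add: b_def)
  then have qq: "cdot q q = 1 - b * cnj b"
    by (simp only: cdot_self of_real_diff of_real_1 complex_norm_square)
  have "cdot w u = \<kappa> - c * (1 - b)"
    by (simp add: w_def cdot.diff_left cdot_smult_left cdot_u_u qu)
  then have wu: "cdot w u = 0"
    using cb by (simp add: \<kappa>_def algebra_simps)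
  \<comment> \<open>The horosphere equation enters through \<open>qq\<close>; it makes the squared
    norm of \<open>w\<close> equal to 2 Re \<kappa>, as the exponential formula demands.\<close>
  have "cdot w w = cnj \<kappa> * cdot w u - cnj c * cdot w q"
    unfolding w_def by (simp add: cdot.diff_right cdot_smult_right)
  also have "\<dots> = - cnj c * (\<kappa> * (1 - cnj b) - c * (1 - b * cnj b))"
    by (simp add: wu) (simp add: w_def cdot.diff_left cdot_smult_left qu qq)
  also have "\<dots> = - (cnj c * \<kappa>) + (cnj c * cnj b) * \<kappa> + cnj c * c - (c * b) * (cnj c * cnj b)"
    by (simp add: algebra_simps)
  also have "\<dots> = \<kappa> + cnj \<kappa>"
    unfolding cb by (simp add: \<kappa>_def algebra_simps)
  finally have "of_real ((norm w)\<^sup>2) = complex_of_real (2 * Re \<kappa>)"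
    by (simp only: cdot_self complex_add_cnj)
  then have nw: "(norm w)\<^sup>2 / 2 = Re \<kappa>" by (simp only: of_real_eq_iff)
  \<comment> \<open>The centre of N supplies the imaginary part: -2 s = Im \<kappa>.\<close>
  define s where "s = - Im \<kappa> / 2"
  have k: "of_real ((norm w)\<^sup>2 / 2) - 2 * \<i> * of_real s = \<kappa>"
    unfolding nw s_def by (simp add: complex_eq_iff)
  have "mat_exp (rank2 ((lift w - lift 0) + (\<i> * of_real s) *s \<xi>) \<xi>) *v lift 0
      = lift 0 - (lift w - lift 0) + \<kappa> *s \<xi>"
    unfolding exp_rank2_vec_origin[OF wu] k ..
  also have "\<dots> = c *s lift q"
    by (simp add: vec_option_eq_iff w_def \<kappa>_def)
  finally show ?thesis
    using that[of _ c] cb(2) rank2_\<nn>[OF wu, of s] unfolding iwasawa_N_\<nn> by blast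
qed

end

section \<open>Non-symmetric homogeneous descriptions\<close>

lemma GL_components [simp]: "carrier GL = {A. invertible A}" "mult GL = (**)" "one GL = mat 1"
  by (simp_all add: GL_def)

lemma group_GL: "group (GL :: (complex ^ 'i::finite ^ 'i) monoid)"
proof (rule groupI)
  fix A :: "complex ^ 'i ^ 'i" assume "A \<in> carrier GL"
  then show "\<exists>B\<in>carrier GL. B \<otimes>\<^bsub>GL\<^esub> A = \<one>\<^bsub>GL\<^esub>"
    by (auto simp: invertible_def)
qed (auto simp: invertible_mult matrix_mul_assoc, simp add: invertible_def exI[of _ "mat 1"])

lemma space_part_vanishing_imp_derivative:
  assumes "\<And>t. space_part (mat_exp (t *\<^sub>R X) *v y) = 0"
  shows "space_part (X *v y) = 0"
proof -
  have "((\<lambda>t. space_part (mat_exp (t *\<^sub>R X) *v y)) has_vector_derivative space_part (X *v y)) (at 0)"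
    using bounded_linear.has_vector_derivative[OF bounded_linear_space_part mat_exp_vec_has_vector_derivative[of X y 0]]
    by simp
  then show ?thesis
    unfolding assms by (metis has_vector_derivative_const vector_derivative_unique_at)
qed

text \<open>The denominator contributes nothing to the derivative, because the spatial part of
  \<open>lift 0\<close> is 0.\<close>

lemma orbit_has_vector_derivative:
  "((\<lambda>t. act (mat_exp (t *\<^sub>R X)) 0) has_vector_derivative space_part (X *v lift 0)) (at 0)"
proof -
  let ?y = "\<lambda>t. mat_exp (t *\<^sub>R X) *v lift (0 :: complex ^ 'a)"
  have y: "(?y has_vector_derivative X *v lift 0) (at 0)"
    using mat_exp_vec_has_vector_derivative[of X "lift 0" 0] by simp
  have q: "((\<lambda>t. ?y t $ None) has_derivative (\<lambda>h. h *\<^sub>R (X *v lift 0) $ None)) (at 0)"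
    using bounded_linear.has_vector_derivative[OF bounded_linear_vec_nth y] by (simp add: has_vector_derivative_def)
  have "((\<lambda>t. inverse (?y t $ None)) has_vector_derivative - (X *v lift 0) $ None) (at 0)"
    unfolding has_vector_derivative_def
    by (rule has_derivative_eq_rhs[OF Deriv.has_derivative_inverse[OF _ q]]) auto
  from sm.has_vector_derivative[OF this bounded_linear.has_vector_derivative[OF bounded_linear_space_part y]]
  have "((\<lambda>t. inverse (?y t $ None) *s space_part (?y t)) has_vector_derivative space_part (X *v lift 0)) (at 0)"
    by simp
  moreover have "act g 0 = inverse ((g *v lift 0) $ None) *s space_part (g *v lift 0)" for g :: "'a cmat"
    by (simp add: vec_eq_iff act_def divide_inverse mult.commute)
  ultimately show ?thesis by simp
qed

locale homogeneous_description = rank_one T for T :: "'n::finite cmat" +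
  fixes F G H :: "'n cmat set"
  assumes F_group: "subgroup F GL"
    and F_MA: "F \<subseteq> mat_set_mult (centralizer_M T) (iwasawa_A T)"
    and F_closed: "closedin (top_of_set (mat_set_mult (centralizer_M T) (iwasawa_A T))) F"
    and F_connected: "connected F"
    and F_nontrivial: "\<exists>m\<in>centralizer_M T. \<exists>a\<in>iwasawa_A T. m ** a \<in> F \<and> a \<noteq> mat 1"
    and G_eq: "G = mat_set_mult F (iwasawa_N T)"
    and H_eq: "H = F \<inter> centralizer_M T"
begin

lemma F_eigen:
  assumes "f \<in> F" shows "isometric f" and "\<exists>c. f *v \<xi> = c *s \<xi>"
proof -
  obtain m t where "m \<in> centralizer_M T" "f = m ** mat_exp (t *\<^sub>R T)"
    using assms F_MA by (auto simp: mat_set_mult_def iwasawa_A_def)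
  then show "isometric f" "\<exists>c. f *v \<xi> = c *s \<xi>"
    using MA_eigen(1,2) by blast+
qed

text \<open>The character grows like exp(t Re \<mu>) along the subgroup, so a nonzero real part says
  that it moves the horospheres centred at \<open>u\<close>.\<close>

lemma F_one_parameter:
  obtains X \<mu> where "\<And>t. mat_exp (t *\<^sub>R X) \<in> F" and "X *v \<xi> = \<mu> *s \<xi>" and "Re \<mu> \<noteq> 0"
proof -
  interpret GL: group "GL :: 'n cmat monoid" by (rule group_GL)
  interpret F: subgroup F GL by (rule F_group)
  obtain m a where ma: "m \<in> centralizer_M T" "a \<in> iwasawa_A T" "m ** a \<in> F" "a \<noteq> mat 1"
    using F_nontrivial by blast
  then obtain t where t: "a = mat_exp (t *\<^sub>R T)" by (auto simp: iwasawa_A_def)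
  then have "t \<noteq> 0" using ma(4) by auto
  then have nt: "\<nu> (m ** a) \<noteq> 1" using MA_eigen(3)[OF ma(1), of t] \<tau>_pos by (simp add: t)
  obtain C where C: "closed C" "F = mat_set_mult (centralizer_M T) (iwasawa_A T) \<inter> C"
    using F_closed by (auto simp: closedin_closed)
  obtain X where X: "\<And>t. mat_exp (t *\<^sub>R X) \<in> F" "\<exists>t. \<nu> (mat_exp (t *\<^sub>R X)) \<noteq> 1"
  proof (rule closed_group_one_parameter_subgroup[of F \<nu> "m ** a"])
    show "mat 1 \<in> F" using F.one_closed by simp
    show "f ** g \<in> F" if "f \<in> F" "g \<in> F" for f g using F.m_closed[OF that] by simp
    show "\<exists>h\<in>F. h ** f = mat 1" if f: "f \<in> F" for f
      using F.m_inv_closed[OF f] GL.l_inv[OF F.mem_carrier[OF f]] by auto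
    show "l \<in> F" if s: "\<And>k::nat. s k \<in> F" "s \<longlonglongrightarrow> l" and h: "h ** l = mat 1" for s l h
      using MA_closed[OF _ s(2) h] s C closed_sequentially[OF C(1) _ s(2)] by blast
    show "\<nu> (f ** g) = \<nu> f * \<nu> g" if fg: "f \<in> F" "g \<in> F" for f g
    proof -
      obtain c d where cd: "f *v \<xi> = c *s \<xi>" "g *v \<xi> = d *s \<xi>" using F_eigen(2) fg by meson
      then have "(f ** g) *v \<xi> = (d * c) *s \<xi>"
        by (simp add: matrix_vector_mul_assoc[symmetric] matrix_vector_mult_smult)
      from \<nu>_eigen[OF this] \<nu>_eigen[OF cd(1)] \<nu>_eigen[OF cd(2)] show ?thesis by (simp add: norm_mult)
    qed
    show "\<nu> (mat 1) = 1" using norm_\<xi> by (simp add: \<nu>_def)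
  qed (use F_connected continuous_\<nu> ma nt in auto)
  let ?c = "\<lambda>t. (mat_exp (t *\<^sub>R X) *v \<xi>) $ None"
  \<comment> \<open>Since \<open>\<xi>\<close> has last coordinate 1, the eigenvalue is a coordinate
    of the orbit, hence differentiable in t.\<close>
  have ev: "mat_exp (t *\<^sub>R X) *v \<xi> = ?c t *s \<xi>" for t
  proof -
    obtain c where "mat_exp (t *\<^sub>R X) *v \<xi> = c *s \<xi>" using F_eigen(2)[OF X(1)] by blast
    then show ?thesis by simp
  qed
  have d: "((\<lambda>t. mat_exp (t *\<^sub>R X) *v \<xi>) has_vector_derivative X *v \<xi>) (at 0)"
    using mat_exp_vec_has_vector_derivative[of X \<xi> 0] by simp
  from bounded_linear.has_vector_derivative[OF sm.bounded_linear_left bounded_linear.has_vector_derivative[OF bounded_linear_vec_nth this]]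
  have "((\<lambda>t. ?c t *s \<xi>) has_vector_derivative ((X *v \<xi>) $ None) *s \<xi>) (at 0)" .
  then have X\<xi>: "X *v \<xi> = ((X *v \<xi>) $ None) *s \<xi>"
    using d unfolding ev[symmetric] by (blast intro: vector_derivative_unique_at)
  define \<mu> where "\<mu> = (X *v \<xi>) $ None"
  have "(t *\<^sub>R X) *v \<xi> = (of_real t * \<mu>) *s \<xi>" for t
    using X\<xi> unfolding \<mu>_def[symmetric]
    by (simp add: mv.scaleR_left vec_eq_iff scaleR_conv_of_real[where 'a=complex])
  from \<nu>_eigen[OF mat_exp_eigenvector[OF this]] X(2) have "Re \<mu> \<noteq> 0" by auto
  then show ?thesis using that X(1) X\<xi> unfolding \<mu>_def by blast
qed

lemma mem_G: "f \<in> F \<Longrightarrow> n \<in> iwasawa_N T \<Longrightarrow> f ** n \<in> G"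
  unfolding G_eq mat_set_mult_def by blast

lemma F_subset_G: "F \<subseteq> G"
proof
  fix f assume "f \<in> F"
  moreover have "mat 1 \<in> iwasawa_N T" unfolding iwasawa_N_\<nn> using \<nn>_zero mat_exp_0 by force
  ultimately show "f \<in> G" using mem_G by (metis matrix_mul_rid)
qed

lemma \<nn>_subset_lie_algebra_G: "\<nn> \<subseteq> lie_algebra G"
proof
  fix X assume "X \<in> \<nn>"
  then have N: "mat_exp (t *\<^sub>R X) \<in> iwasawa_N T" for t unfolding iwasawa_N_\<nn> using \<nn>_scaleR by blast
  have "mat 1 \<in> F"
    using F_group subgroup.one_closed by fastforce
  from mem_G[OF this N] show "X \<in> lie_algebra G"
    by (simp add: lie_algebra_def)
qed

lemma G_eigen:
  assumes "g \<in> G" shows "isometric g" and "\<exists>c. g *v \<xi> = c *s \<xi>"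
proof -
  obtain f n where fn: "f \<in> F" "n \<in> iwasawa_N T" "g = f ** n"
    using assms by (auto simp: G_eq mat_set_mult_def)
  show "isometric g" unfolding fn(3) by (intro isometric_mult F_eigen(1) iwasawa_N_fixes(1) fn)
  show "\<exists>c. g *v \<xi> = c *s \<xi>"
    unfolding fn(3) using F_eigen(2)[OF fn(1)] iwasawa_N_fixes(2)[OF fn(2)]
    by (simp add: matrix_vector_mul_assoc[symmetric])
qed

text \<open>A one-parameter subgroup of \<open>F\<close> permutes the horospheres centred at \<open>u\<close> transitively.\<close>

lemma G_transitive:
  assumes p: "p \<in> CH"
  obtains g where "g \<in> G" and "act g 0 = p"
proof -
  obtain X \<mu> where X: "\<And>t. mat_exp (t *\<^sub>R X) \<in> F" "X *v \<xi> = \<mu> *s \<xi>" "Re \<mu> \<noteq> 0"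
    by (rule F_one_parameter) blast
  define \<beta> where "\<beta> = (1 - (norm p)\<^sup>2) / (norm (1 - cdot p u))\<^sup>2"
  \<comment> \<open>\<open>\<beta>\<close> labels the horosphere through \<open>p\<close> centred at
    \<open>u\<close>; the one through the origin has label 1.\<close>
  have ne: "1 - cdot p u \<noteq> 0"
    using one_minus_cdot_nonzero[OF norm_u p] cnj_cdot[of u p] by auto
  have "(norm p)\<^sup>2 < 1" using p by (simp add: CH_def power_less_one_iff)
  then have \<beta>: "\<beta> > 0" using ne by (simp add: \<beta>_def)
  \<comment> \<open>The label is multiplied under exp(-tX) by exp(-2 t Re \<mu>), the squared
    modulus of the eigenvalue on \<open>\<xi>\<close>. This \<open>t\<close> brings it to 1.\<close>
  define t where "t = ln \<beta> / (2 * Re \<mu>)"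
  define f g where "f = mat_exp (t *\<^sub>R X)" and "g = mat_exp ((- t) *\<^sub>R X)"
  have fg: "f ** g = mat 1" "f \<in> F" "isometric f" "isometric g"
    unfolding f_def g_def by (rule mat_exp_mult_minus X(1) F_eigen(1)[OF X(1)])+
  define q k where "q = act g p" and "k = (g *v lift p) $ None"
  note gp = isometric_None_nonzero[OF fg(4) p, folded k_def q_def]
  have k: "g *v lift p = k *s lift q" using gp by simp
  have "((- t) *\<^sub>R X) *v \<xi> = (of_real (- t) * \<mu>) *s \<xi>"
    by (simp add: mv.minus_left mv.scaleR_left X(2) vec_eq_iff scaleR_conv_of_real[where 'a=complex])
  from mat_exp_eigenvector[OF this] have g\<xi>: "g *v \<xi> = exp (of_real (- t) * \<mu>) *s \<xi>" (is "_ = ?e *s _")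
    by (simp only: g_def)
  have "herm (g *v lift p) (g *v lift p) = herm (lift p) (lift p)"
    using fg(4) unfolding isometric_def by blast
  then have "herm (lift p) (lift p) = k * cnj k * herm (lift q) (lift q)"
    unfolding k herm_smult_left herm_smult_right by (simp only: mult_ac)
  then have "of_real ((norm p)\<^sup>2 - 1) = complex_of_real ((norm k)\<^sup>2 * ((norm q)\<^sup>2 - 1))"
    by (simp only: herm_lift cdot_self of_real_mult of_real_diff of_real_1 complex_norm_square)
  then have 1: "(norm p)\<^sup>2 - 1 = (norm k)\<^sup>2 * ((norm q)\<^sup>2 - 1)"
    by (simp only: of_real_eq_iff)
  have "herm (g *v lift p) (g *v \<xi>) = herm (lift p) \<xi>"
    using fg(4) unfolding isometric_def by blast
  then have "herm (lift p) \<xi> = k * cnj ?e * herm (lift q) \<xi>"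
    unfolding k g\<xi> herm_smult_left herm_smult_right by (simp only: mult_ac)
  then have "norm (cdot p u - 1) = norm k * norm ?e * norm (cdot q u - 1)"
    by (simp add: herm_lift norm_mult)
  then have "(norm (cdot p u - 1))\<^sup>2 = (norm k)\<^sup>2 * (norm ?e)\<^sup>2 * (norm (cdot q u - 1))\<^sup>2"
    by (simp only: power_mult_distrib)
  moreover have "(norm ?e)\<^sup>2 = 1 / \<beta>"
  proof -
    have "(norm ?e)\<^sup>2 = exp (- (2 * t * Re \<mu>))"
      by (simp add: power2_eq_square exp_add[symmetric])
    also have "2 * t * Re \<mu> = ln \<beta>" using X(3) by (simp add: t_def)
    finally show ?thesis by (simp only: exp_minus exp_ln[OF \<beta>] inverse_eq_divide)
  qed
  ultimately have 2: "(norm (1 - cdot p u))\<^sup>2 = (norm k)\<^sup>2 / \<beta> * (norm (1 - cdot q u))\<^sup>2"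
    by (simp add: norm_minus_commute[of _ 1])
  have "1 - (norm q)\<^sup>2 = (norm (1 - cdot q u))\<^sup>2"
  proof -
    have "1 - (norm p)\<^sup>2 = \<beta> * (norm (1 - cdot p u))\<^sup>2" using ne by (simp add: \<beta>_def)
    also have "\<dots> = (norm k)\<^sup>2 * (norm (1 - cdot q u))\<^sup>2" unfolding 2 using \<beta> by simp
    also have "1 - (norm p)\<^sup>2 = (norm k)\<^sup>2 * (1 - (norm q)\<^sup>2)" using 1 by (simp add: algebra_simps)
    finally show ?thesis using gp(1) by simp
  qed
  moreover have "cdot q u \<noteq> 1" using 2 ne by auto
  ultimately obtain n c where n: "n \<in> iwasawa_N T" "c \<noteq> 0" "n *v lift 0 = c *s lift q"
    by (rule horosphere_transitive)
  have "f *v (g *v lift p) = lift p"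
    by (simp add: matrix_vector_mul_assoc fg(1))
  then have "(1 / k) *s (k *s (f *v lift q)) = (1 / k) *s lift p"
    by (simp only: k matrix_vector_mult_smult)
  then have "f *v lift q = (1 / k) *s lift p"
    using gp(1) by simp
  then have "(f ** n) *v lift 0 = (c * (1 / k)) *s lift p"
    by (simp add: matrix_vector_mul_assoc[symmetric] n(3) matrix_vector_mult_smult)
  then have "act (f ** n) 0 = p"
    by (rule act_eqI) (use n(2) gp(1) in auto)
  then show ?thesis using that mem_G[OF fg(2) n(1)] by blast
qed

lemma invariant_field:
  assumes "g \<in> G" and "z \<in> CH"
  shows "dact g z (a *s horo_field u z) = a *s horo_field u (act g z)"
proof -
  obtain c where "g *v \<xi> = c *s \<xi>" using G_eigen(2)[OF assms(1)] by blast
  then show ?thesis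
    by (simp only: dact_smult[OF G_eigen(1)[OF assms(1)] assms(2)]
        horo_field_invariant[OF G_eigen(1)[OF assms(1)] _ norm_u assms(2)])
qed

end

section \<open>The reductive complement and parallelism\<close>

locale canonical = homogeneous_description +
  fixes \<mm> and \<Gamma>
  assumes red: "reductive_decomposition G H \<mm>" and can: "canonical_connection G \<mm> \<Gamma>"
begin

text \<open>The Lie algebra of H moves the origin nowhere, so the complement has the same image as
  that of G. There a velocity of F covers a direction transverse to the horosphere, and N covers the
  real hyperplane orthogonal to \<open>u\<close>.\<close>

lemma \<mm>_onto_tangent_space: obtains X where "X \<in> \<mm>" and "space_part (X *v lift 0) = v"
proof -
  define \<phi> where "\<phi> X = space_part (X *v lift 0)" for X :: "'a cmat"
  have lin: "linear \<phi>"
    unfolding \<phi>_def linear_conv_bounded_linear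
    by (rule bounded_linear_compose[OF bounded_linear_space_part mv.bounded_linear_left])
  then have S: "subspace (\<phi> ` \<mm>)"
    using red by (intro linear_subspace_image) (auto simp: reductive_decomposition_def)
  have H0: "\<phi> X = 0" if "X \<in> lie_algebra H" for X
    unfolding \<phi>_def
  proof (rule space_part_vanishing_imp_derivative)
    fix t
    have m: "mat_exp (t *\<^sub>R X) \<in> centralizer_M T" using that by (simp add: lie_algebra_def H_eq)
    show "space_part (mat_exp (t *\<^sub>R X) *v lift 0) = 0"
      by (simp add: vec_eq_iff matrix_vector_mult_def sum_option centralizer_M_eigen(5)[OF m])
  qed
  have G: "\<phi> X \<in> \<phi> ` \<mm>" if "X \<in> lie_algebra G" for X
    using that red H0 linear_add[OF lin] by (auto simp: reductive_decomposition_def)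
  obtain X \<mu> where X: "\<And>t. mat_exp (t *\<^sub>R X) \<in> F" "X *v \<xi> = \<mu> *s \<xi>" "Re \<mu> \<noteq> 0"
    by (rule F_one_parameter) blast
  have XS: "\<phi> X \<in> \<phi> ` \<mm>" using G X(1) F_subset_G by (auto simp: lie_algebra_def)
  have Xu: "\<phi> X \<bullet> u = Re \<mu>"
  proof -
    have sk: "skew X" by (rule skew_if_isometric_mat_exp) (rule F_eigen(1)[OF X(1)])
    \<comment> \<open>The first identity computes the component along \<open>u\<close>; the second
      makes its correction imaginary.\<close>
    have "herm (X *v lift 0) \<xi> + herm (lift 0) (X *v \<xi>) = 0" "herm (X *v lift 0) (lift 0) + herm (lift 0) (X *v lift 0) = 0"
      using sk by (simp_all add: skew_def)
    then have "cdot (\<phi> X) u - (X *v lift 0) $ None - cnj \<mu> = 0" "Re ((X *v lift 0) $ None) = 0"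
      by (auto simp: X(2) herm_smult_right herm_lift) 
         (auto simp: herm_def \<phi>_def cdot.zero_left cdot.zero_right complex_eq_iff)
    then show ?thesis unfolding Re_cdot[symmetric] by (auto simp: complex_eq_iff)
  qed
  define v0 where "v0 = v - ((v \<bullet> u) / Re \<mu>) *\<^sub>R \<phi> X"
  have "v0 \<bullet> u = 0" using X(3) by (simp add: v0_def inner_diff_left Xu)
  \<comment> \<open>What remains along \<open>u\<close> is i r u. The generator with parameter s
    moves the origin by -w - 2 i s u, whence s = -r / 2 and this \<open>w\<close>.\<close>
  define r where "r = Im (cdot v0 u)"
  define w where "w = (\<i> * of_real r) *s u - v0"
  have "cdot v0 u = \<i> * of_real r" using \<open>v0 \<bullet> u = 0\<close> Re_cdot[of v0 u] by (simp add: complex_eq_iff r_def)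
  then have wu: "cdot w u = 0" by (simp add: w_def cdot.diff_left cdot_smult_left cdot_u_u)
  define Y where "Y = rank2 ((lift w - lift 0) + (\<i> * of_real (- r / 2)) *s \<xi>) \<xi>"
  have "\<phi> Y = v0"
    using wu cnj_cdot[of w u]
    by (simp add: \<phi>_def Y_def rank2_vec herm_def cdot.zero_left vec_eq_iff)
       (simp add: w_def algebra_simps)
  then have "v0 \<in> \<phi> ` \<mm>"
    using G[of Y] rank2_\<nn>[OF wu] \<nn>_subset_lie_algebra_G unfolding Y_def by blast
  then have "v0 + ((v \<bullet> u) / Re \<mu>) *\<^sub>R \<phi> X \<in> \<phi> ` \<mm>"
    by (intro subspace_add[OF S] subspace_scale[OF S] XS)
  then have "v \<in> \<phi> ` \<mm>" by (simp add: v0_def)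
  then show ?thesis using that by (auto simp: \<phi>_def)
qed

lemma parallel_horo_field: "parallel_field \<Gamma> (\<lambda>z. a *s horo_field u z)"
proof -
  let ?Y = "\<lambda>z. a *s horo_field u z"
  have smooth: "smooth_on CH ?Y"
    by (intro smooth_on_smult smooth_on_horo_field norm_u)
  then have "Ck_on (Suc 0) CH ?Y" by (simp only: smooth_on_def)
  then have der: "(?Y has_derivative frechet_derivative ?Y (at z)) (at z)" if "z \<in> CH" for z
    using Ck_on_SucD(1)[of CH 0 ?Y z] that by (simp add: CH_def)
  have 0: "(0 :: complex ^ 'a) \<in> CH" by (simp add: CH_def)
  have at_0: "cov_deriv \<Gamma> ?Y 0 v = 0" for v
  proof -
    obtain X where X: "X \<in> \<mm>" "space_part (X *v lift 0) = v" by (rule \<mm>_onto_tangent_space)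
    have XG: "mat_exp (t *\<^sub>R X) \<in> G" for t
      using X(1) red by (auto simp: reductive_decomposition_def lie_algebra_def)
    let ?c = "\<lambda>t. act (mat_exp (t *\<^sub>R X)) 0"
    have c: "(?c has_vector_derivative v) (at 0)" using orbit_has_vector_derivative[of X] X(2) by simp
    have c0: "?c 0 = 0" by (simp add: act_def vec_eq_iff)
    have "((?Y \<circ> ?c) has_derivative (frechet_derivative ?Y (at 0) \<circ> (\<lambda>h. h *\<^sub>R v))) (at 0)"
      using c der[OF 0] c0 by (intro diff_chain_at) (simp_all add: has_vector_derivative_def)
    moreover have "frechet_derivative ?Y (at 0) \<circ> (\<lambda>h. h *\<^sub>R v) = (\<lambda>h. h *\<^sub>R frechet_derivative ?Y (at 0) v)"
      using has_derivative_bounded_linear[OF der[OF 0]] by (simp add: fun_eq_iff linear_simps)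
    ultimately have "((\<lambda>t. ?Y (?c t)) has_vector_derivative frechet_derivative ?Y (at 0) v) (at 0)"
      by (simp add: has_vector_derivative_def o_def)
    moreover have "dact (mat_exp (t *\<^sub>R X)) 0 (a *s u) = ?Y (?c t)" for t
      using invariant_field[OF XG 0, of t a] by simp
    ultimately have "wang_map \<Gamma> X (a *s u) = frechet_derivative ?Y (at 0) v + \<Gamma> 0 v (?Y 0)"
      unfolding wang_map_def cov_deriv_along_def
      by (simp only: vector_derivative_at[OF c] c0 vector_derivative_at)
    then show ?thesis
      using can X(1) by (simp add: cov_deriv_def canonical_connection_def)
  qed
  have "cov_deriv \<Gamma> ?Y p v = 0" if p: "p \<in> CH" for p v
  proof -
    obtain g where g: "g \<in> G" "act g 0 = p" using G_transitive[OF p] by blast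
    note iso = G_eigen(1)[OF g(1)] and inv = isometric_invertible[OF G_eigen(1)[OF g(1)]]
    obtain w where w: "dact g 0 w = v" using surj_dact[OF iso inv(2) 0] by blast
    have push: "push_forward g ?Y z = ?Y z" if z: "z \<in> CH" for z
    proof -
      have z': "act (matrix_inv g) z \<in> CH" by (rule isometric_None_nonzero(2)[OF inv(4) z])
      have "act g (act (matrix_inv g) z) = act (g ** matrix_inv g) z"
        by (rule act_mult[OF inv(4) iso z, symmetric])
      also have "\<dots> = z" unfolding inv(2) by (rule act_eqI[of _ _ 1]) simp_all
      finally show ?thesis using invariant_field[OF g(1) z'] by (simp add: push_forward_def)
    qed
    \<comment> \<open>The two fields are compared only on the ball, which is open and so determines
      the derivative at \<open>p\<close>.\<close>
    have "frechet_derivative (push_forward g ?Y) (at p) = frechet_derivative ?Y (at p)"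
      by (rule frechet_derivative_transform_within_open[symmetric, OF differentiableI[OF der[OF p]], of CH])
         (use p push in \<open>auto simp: CH_def\<close>)
    then have "cov_deriv \<Gamma> ?Y p v = cov_deriv \<Gamma> (push_forward g ?Y) (act g 0) (dact g 0 w)"
      by (simp add: cov_deriv_def g(2) w push[OF p])
    also have "\<dots> = dact g 0 (cov_deriv \<Gamma> ?Y 0 w)"
      using can g(1) smooth 0 by (simp add: canonical_connection_def invariant_connection_def)
    also have "\<dots> = 0"
      using dact_smult[OF iso 0, of 0] by (simp add: at_0)
    finally show ?thesis .
  qed
  then show ?thesis by (simp add: parallel_field_def)
qed

end

theorem corollary3p4:
  fixes T :: "'n::finite cmat"
    and F G H \<mm> :: "'n cmat set"
    and \<Gamma> :: "complex ^ 'n \<Rightarrow> complex ^ 'n \<Rightarrow> complex ^ 'n \<Rightarrow> complex ^ 'n"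
  assumes "T \<in> cartan_p" and "T \<noteq> 0"
    and "subgroup F GL"
    and "F \<subseteq> mat_set_mult (centralizer_M T) (iwasawa_A T)"
    and "closedin (top_of_set (mat_set_mult (centralizer_M T) (iwasawa_A T))) F"
    and "connected F"
    and nontrivial_projection:
      "\<exists>m\<in>centralizer_M T. \<exists>a\<in>iwasawa_A T. m ** a \<in> F \<and> a \<noteq> mat 1"
    and "G = mat_set_mult F (iwasawa_N T)"
    and "H = F \<inter> centralizer_M T"
    and "reductive_decomposition G H \<mm>"
    and "canonical_connection G \<mm> \<Gamma>"
  shows "\<exists>Y1 Y2. smooth_on CH Y1 \<and> smooth_on CH Y2 \<and>
           parallel_field \<Gamma> Y1 \<and> parallel_field \<Gamma> Y2 \<and>
           (\<forall>p\<in>CH. Y1 p \<noteq> 0 \<and> Y2 p \<noteq> 0 \<and> \<not> collinear {0, Y1 p, Y2 p})"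
proof -
  interpret canonical T F G H \<mm> \<Gamma>
    by (intro canonical.intro homogeneous_description.intro rank_one.intro
        homogeneous_description_axioms.intro canonical_axioms.intro assms)
  have nz: "horo_field u p \<noteq> 0" if "p \<in> CH" for p
    by (rule horo_field_nonzero[OF norm_u that])
  \<comment> \<open>\<open>collinear\<close> is a real notion, so a nonzero vector and its multiple
    by \<open>\<i>\<close> are never collinear with 0.\<close>
  have "\<not> collinear {0, y, \<i> *s y}" and "\<i> *s y \<noteq> 0" if y: "y \<noteq> 0" for y :: "complex ^ 'n"
  proof -
    have "\<i> *s y \<noteq> c *\<^sub>R y" for c
    proof
      assume "\<i> *s y = c *\<^sub>R y"
      then have "\<i> * y $ j = of_real c * y $ j" for j
        by (metis scaleR_conv_of_real vector_scaleR_component vector_smult_component)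
      then have "(\<i> - of_real c) * y $ j = 0" for j by (simp add: left_diff_distrib)
      moreover have "\<i> - of_real c \<noteq> 0" by (simp add: complex_eq_iff)
      ultimately have "y $ j = 0" for j by (metis mult_eq_0_iff)
      then show False using y by (simp add: vec_eq_iff)
    qed
    from this[of 0] this show "\<i> *s y \<noteq> 0" "\<not> collinear {0, y, \<i> *s y}"
      using y by (auto simp: collinear_lemma)
  qed
  then show ?thesis
    using parallel_horo_field[of 1] parallel_horo_field[of \<i>] nz smooth_on_horo_field[OF norm_u] smooth_on_smult[OF smooth_on_horo_field[OF norm_u], of \<i>]
    by (intro exI[of _ "horo_field u"] exI[of _ "\<lambda>z. \<i> *s horo_field u z"]) simp
qed

end
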